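(* Let $k$ be a field, let $(\mathcal{A},\mu,\alpha)$ be a multiplicative Hom-associative algebra over $k$, and let $(V,\beta)$ be an $\mathcal{A}$-bimodule such that $\beta(v\cdot a)=\beta(v)\cdot\alpha(a)$ and $\beta(a\cdot v)=\alpha(a)\cdot\beta(v)$ for all $a\in\mathcal{A}$, $v\in V$. For $n\ge 0$ put $C^{Hom}_n(\mathcal{A},V):=V\otimes\mathcal{A}^{\otimes n}$, and for $n\geq 1$ define linear maps $\delta_i:C^{Hom}_n(\mathcal{A},V)\to C^{Hom}_{n-1}(\mathcal{A},V)$, $0\le i\le n$, by $$\delta_0(v\otimes a_1\otimes\cdots\otimes a_n)=v\cdot a_1\otimes\alpha(a_2)\otimes\cdots\otimes\alpha(a_n),$$ $$\delta_i(v\otimes a_1\otimes\cdots\otimes a_n)=\beta(v)\otimes\alpha(a_1)\otimes\cdots\otimes a_ia_{i+1}\otimes\cdots\otimes\alpha(a_n),\quad 1\le i\le n-1,$$ $$\delta_n(v\otimes a_1\otimes\cdots\otimes a_n)=a_n\cdot v\otimes\alpha(a_1)\otimes\cdots\otimes\alpha(a_{n-1}).$$ Then $C^{Hom}_\ast(\mathcal{A},V)=\bigoplus_{n\ge 0}C^{Hom}_n(\mathcal{A},V)$ with the face maps $\delta_i$ is a presimplicial module, i.e. $\delta_i\delta_j=\delta_{j-1}\delta_i$ on $C^{Hom}_n(\mathcal{A},V)$ for all $n\geq 2$ and $0\le i<j\le n$.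
   Context: All vector spaces and tensor products are over a field $k$. A Hom-associative algebra $(\mathcal{A},\mu,\alpha)$ is a $k$-vector space $\mathcal{A}$ with linear maps $\mu:\mathcal{A}\otimes\mathcal{A}\to\mathcal{A}$, written $\mu(a\otimes b)=ab$, and $\alpha:\mathcal{A}\to\mathcal{A}$ such that $\alpha(a)(bc)=(ab)\alpha(c)$ for all $a,b,c$. It is multiplicative if $\alpha(ab)=\alpha(a)\alpha(b)$ for all $a,b$. No unit is assumed. An $\mathcal{A}$-bimodule is a vector space $V$ with linear maps $\mathcal{A}\otimes V\to V$, $a\otimes v\mapsto a\cdot v$, $V\otimes\mathcal{A}\to V$, $v\otimes a\mapsto v\cdot a$, and $\beta:V\to V$ such that for all $a,b\in\mathcal{A}$, $v\in V$: $(ab)\cdot\beta(v)=\alpha(a)\cdot(b\cdot v)$ (left module), $\beta(v)\cdot(ab)=(v\cdot a)\cdot\alpha(b)$ (right module), and $\alpha(a)\cdot(v\cdot b)=(a\cdot v)\cdot\alpha(b)$. *)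

theory Defs
  imports "HOL-Algebra.Module" "HOL-Algebra.AbelCoset" "HOL.Hull"
begin

section \<open>Linear and bilinear maps\<close>

definition linear_maps ::
    "('k, 'r) ring_scheme \<Rightarrow> ('k, 'a, 'm) module_scheme \<Rightarrow> ('k, 'b, 'n) module_scheme \<Rightarrow> ('a \<Rightarrow> 'b) set"
  where "linear_maps K M N =
    {f \<in> carrier M \<rightarrow> carrier N.
      (\<forall>x\<in>carrier M. \<forall>y\<in>carrier M. f (x \<oplus>\<^bsub>M\<^esub> y) = f x \<oplus>\<^bsub>N\<^esub> f y) \<and>
      (\<forall>c\<in>carrier K. \<forall>x\<in>carrier M. f (c \<odot>\<^bsub>M\<^esub> x) = c \<odot>\<^bsub>N\<^esub> f x)}"

text \<open>A linear map on a tensor product of two spaces is given by a bilinear map on the factors.\<close>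

definition bilinear_maps ::
    "('k, 'r) ring_scheme \<Rightarrow> ('k, 'a, 'm) module_scheme \<Rightarrow> ('k, 'b, 'n) module_scheme \<Rightarrow>
      ('k, 'c, 'p) module_scheme \<Rightarrow> ('a \<Rightarrow> 'b \<Rightarrow> 'c) set"
  where "bilinear_maps K M N P =
    {f. (\<forall>x\<in>carrier M. f x \<in> linear_maps K N P) \<and>
        (\<forall>y\<in>carrier N. (\<lambda>x. f x y) \<in> linear_maps K M P)}"


section \<open>Hom-associative algebras and bimodules\<close>

text \<open>
  The vector spaces are HOL-Algebra modules over a field; the ring multiplication and unit fields
  of such a module record are not used.
\<close>

locale hom_associative_algebra = field K + module K A
  for K :: "('k, 'r) ring_scheme" and A :: "('k, 'a, 'm) module_scheme" +
  fixes mu :: "'a \<Rightarrow> 'a \<Rightarrow> 'a" and \<alpha> :: "'a \<Rightarrow> 'a"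
  assumes mu_bilinear: "mu \<in> bilinear_maps K A A A"
    and alpha_linear: "\<alpha> \<in> linear_maps K A A"
    and hom_assoc: "\<lbrakk>a \<in> carrier A; b \<in> carrier A; c \<in> carrier A\<rbrakk> \<Longrightarrow>
      mu (\<alpha> a) (mu b c) = mu (mu a b) (\<alpha> c)"

locale multiplicative_hom_associative_algebra = hom_associative_algebra +
  assumes alpha_mult: "\<lbrakk>a \<in> carrier A; b \<in> carrier A\<rbrakk> \<Longrightarrow> \<alpha> (mu a b) = mu (\<alpha> a) (\<alpha> b)"

locale hom_bimodule = hom_associative_algebra K A mu \<alpha> + V: module K V
  for K :: "('k, 'r) ring_scheme" and A :: "('k, 'a, 'm) module_scheme"
    and mu :: "'a \<Rightarrow> 'a \<Rightarrow> 'a" and \<alpha> :: "'a \<Rightarrow> 'a"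
    and V :: "('k, 'v, 'n) module_scheme" +
  fixes lact :: "'a \<Rightarrow> 'v \<Rightarrow> 'v" and ract :: "'v \<Rightarrow> 'a \<Rightarrow> 'v" and \<beta> :: "'v \<Rightarrow> 'v"
  assumes lact_bilinear: "lact \<in> bilinear_maps K A V V"
    and ract_bilinear: "ract \<in> bilinear_maps K V A V"
    and beta_linear: "\<beta> \<in> linear_maps K V V"
    and left_module: "\<lbrakk>a \<in> carrier A; b \<in> carrier A; v \<in> carrier V\<rbrakk> \<Longrightarrow>
      lact (mu a b) (\<beta> v) = lact (\<alpha> a) (lact b v)"
    and right_module: "\<lbrakk>a \<in> carrier A; b \<in> carrier A; v \<in> carrier V\<rbrakk> \<Longrightarrow>
      ract (\<beta> v) (mu a b) = ract (ract v a) (\<alpha> b)"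
    and bimodule: "\<lbrakk>a \<in> carrier A; b \<in> carrier A; v \<in> carrier V\<rbrakk> \<Longrightarrow>
      lact (\<alpha> a) (ract v b) = ract (lact a v) (\<alpha> b)"


section \<open>The tensor products $V \otimes A^{\otimes n}$\<close>

text \<open>The free module on a set: finitely supported functions with support in that set.\<close>

definition free_module :: "('k, 'r) ring_scheme \<Rightarrow> 's set \<Rightarrow> ('k, 's \<Rightarrow> 'k) module"
  where "free_module K S =
    \<lparr>carrier = {f. range f \<subseteq> carrier K \<and> {s. f s \<noteq> \<zero>\<^bsub>K\<^esub>} \<subseteq> S \<and> finite {s. f s \<noteq> \<zero>\<^bsub>K\<^esub>}},
     mult = undefined, one = undefined,
     zero = (\<lambda>s. \<zero>\<^bsub>K\<^esub>), add = (\<lambda>f g s. f s \<oplus>\<^bsub>K\<^esub> g s),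
     smult = (\<lambda>c f s. c \<otimes>\<^bsub>K\<^esub> f s)\<rparr>"

definition free_gen :: "('k, 'r) ring_scheme \<Rightarrow> 's \<Rightarrow> 's \<Rightarrow> 'k"
  where "free_gen K s = (\<lambda>t. if t = s then \<one>\<^bsub>K\<^esub> else \<zero>\<^bsub>K\<^esub>)"

text \<open>
  The scalar multiple of a coset is written as the union of the (equal) cosets of the scaled
  representatives; elementwise scaling alone would not give a coset for the scalar zero.
\<close>

definition quotient_module :: "('k, 'a, 'm) module_scheme \<Rightarrow> 'a set \<Rightarrow> ('k, 'a set) module"
  where "quotient_module M N =
    \<lparr>carrier = a_rcosets\<^bsub>M\<^esub> N,
     mult = undefined, one = undefined,
     zero = N, add = set_add M,
     smult = (\<lambda>c X. \<Union>x\<in>X. N +>\<^bsub>M\<^esub> (c \<odot>\<^bsub>M\<^esub> x))\<rparr>"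

definition tuples :: "('k, 'a, 'm) module_scheme \<Rightarrow> nat \<Rightarrow> 'a list set"
  where "tuples A n = {as. set as \<subseteq> carrier A \<and> length as = n}"

definition tensor_free ::
    "('k, 'r) ring_scheme \<Rightarrow> ('k, 'v, 'n) module_scheme \<Rightarrow> ('k, 'a, 'm) module_scheme \<Rightarrow> nat \<Rightarrow>
      ('k, 'v \<times> 'a list \<Rightarrow> 'k) module"
  where "tensor_free K V A n = free_module K (carrier V \<times> tuples A n)"

text \<open>The relations expressing linearity in the first argument and in each of the other \<open>n\<close>.\<close>

definition tensor_relations ::
    "('k, 'r) ring_scheme \<Rightarrow> ('k, 'v, 'n) module_scheme \<Rightarrow> ('k, 'a, 'm) module_scheme \<Rightarrow> nat \<Rightarrow>
      ('v \<times> 'a list \<Rightarrow> 'k) set"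
  where "tensor_relations K V A n = (let F = tensor_free K V A n; e = free_gen K in
    {e (v \<oplus>\<^bsub>V\<^esub> w, as) \<ominus>\<^bsub>F\<^esub> (e (v, as) \<oplus>\<^bsub>F\<^esub> e (w, as)) | v w as.
      v \<in> carrier V \<and> w \<in> carrier V \<and> as \<in> tuples A n} \<union>
    {e (c \<odot>\<^bsub>V\<^esub> v, as) \<ominus>\<^bsub>F\<^esub> c \<odot>\<^bsub>F\<^esub> e (v, as) | c v as.
      c \<in> carrier K \<and> v \<in> carrier V \<and> as \<in> tuples A n} \<union>
    {e (v, as[j := a \<oplus>\<^bsub>A\<^esub> b]) \<ominus>\<^bsub>F\<^esub> (e (v, as[j := a]) \<oplus>\<^bsub>F\<^esub> e (v, as[j := b])) | v as j a b.
      v \<in> carrier V \<and> as \<in> tuples A n \<and> j < n \<and> a \<in> carrier A \<and> b \<in> carrier A} \<union>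
    {e (v, as[j := c \<odot>\<^bsub>A\<^esub> a]) \<ominus>\<^bsub>F\<^esub> c \<odot>\<^bsub>F\<^esub> e (v, as[j := a]) | v as j c a.
      v \<in> carrier V \<and> as \<in> tuples A n \<and> j < n \<and> c \<in> carrier K \<and> a \<in> carrier A})"

definition tensor_null ::
    "('k, 'r) ring_scheme \<Rightarrow> ('k, 'v, 'n) module_scheme \<Rightarrow> ('k, 'a, 'm) module_scheme \<Rightarrow> nat \<Rightarrow>
      ('v \<times> 'a list \<Rightarrow> 'k) set"
  where "tensor_null K V A n =
    (\<lambda>H. submodule H K (tensor_free K V A n)) hull tensor_relations K V A n"

text \<open>
  The degree \<open>n\<close> part $V \otimes A^{\otimes n}$ of the complex, and its element
  $v \otimes a_1 \otimes \cdots \otimes a_n$.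
\<close>

definition C_Hom ::
    "('k, 'r) ring_scheme \<Rightarrow> ('k, 'a, 'm) module_scheme \<Rightarrow> ('k, 'v, 'n) module_scheme \<Rightarrow> nat \<Rightarrow>
      ('k, ('v \<times> 'a list \<Rightarrow> 'k) set) module"
  where "C_Hom K A V n = quotient_module (tensor_free K V A n) (tensor_null K V A n)"

definition pure_tensor ::
    "('k, 'r) ring_scheme \<Rightarrow> ('k, 'a, 'm) module_scheme \<Rightarrow> ('k, 'v, 'n) module_scheme \<Rightarrow>
      'v \<Rightarrow> 'a list \<Rightarrow> ('v \<times> 'a list \<Rightarrow> 'k) set"
  where "pure_tensor K A V v as =
    tensor_null K V A (length as) +>\<^bsub>tensor_free K V A (length as)\<^esub> free_gen K (v, as)"


section \<open>Presimplicial modules and the Hom face maps\<close>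

text \<open>A face map \<open>d n i\<close> goes from degree \<open>n\<close> to degree \<open>n - 1\<close>.\<close>

definition presimplicial_module ::
    "('k, 'r) ring_scheme \<Rightarrow> (nat \<Rightarrow> ('k, 'c, 'm) module_scheme) \<Rightarrow> (nat \<Rightarrow> nat \<Rightarrow> 'c \<Rightarrow> 'c) \<Rightarrow> bool"
  where "presimplicial_module K C d \<longleftrightarrow>
    (\<forall>n. module K (C n)) \<and>
    (\<forall>n\<ge>1. \<forall>i\<le>n. d n i \<in> linear_maps K (C n) (C (n - 1))) \<and>
    (\<forall>n\<ge>2. \<forall>i j. i < j \<and> j \<le> n \<longrightarrow>
      (\<forall>x\<in>carrier (C n). d (n - 1) i (d n j x) = d (n - 1) (j - 1) (d n i x)))"

text \<open>
  In the formula for \<open>d n i\<close> with \<open>1 \<le> i \<le> n - 1\<close>, the list \<open>as\<close> is $(a_1, \dots, a_{i-1})$,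
  \<open>a\<close> and \<open>b\<close> are $a_i$ and $a_{i+1}$, and \<open>bs\<close> is $(a_{i+2}, \dots, a_n)$.
\<close>

definition hom_face_maps ::
    "('k, 'r) ring_scheme \<Rightarrow> ('k, 'a, 'm) module_scheme \<Rightarrow> ('a \<Rightarrow> 'a \<Rightarrow> 'a) \<Rightarrow> ('a \<Rightarrow> 'a) \<Rightarrow>
      ('k, 'v, 'n) module_scheme \<Rightarrow> ('a \<Rightarrow> 'v \<Rightarrow> 'v) \<Rightarrow> ('v \<Rightarrow> 'a \<Rightarrow> 'v) \<Rightarrow> ('v \<Rightarrow> 'v) \<Rightarrow>
      (nat \<Rightarrow> nat \<Rightarrow> ('v \<times> 'a list \<Rightarrow> 'k) set \<Rightarrow> ('v \<times> 'a list \<Rightarrow> 'k) set) \<Rightarrow> bool"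
  where "hom_face_maps K A mu \<alpha> V lact ract \<beta> d \<longleftrightarrow> (let t = pure_tensor K A V in
    \<forall>n\<ge>1.
      (\<forall>i\<le>n. d n i \<in> linear_maps K (C_Hom K A V n) (C_Hom K A V (n - 1))) \<and>
      (\<forall>v\<in>carrier V. \<forall>a\<in>carrier A. \<forall>as\<in>tuples A (n - 1).
        d n 0 (t v (a # as)) = t (ract v a) (map \<alpha> as)) \<and>
      (\<forall>i. 1 \<le> i \<and> i \<le> n - 1 \<longrightarrow>
        (\<forall>v\<in>carrier V. \<forall>as\<in>tuples A (i - 1). \<forall>a\<in>carrier A. \<forall>b\<in>carrier A. \<forall>bs\<in>tuples A (n - 1 - i).
          d n i (t v (as @ [a, b] @ bs)) = t (\<beta> v) (map \<alpha> as @ [mu a b] @ map \<alpha> bs))) \<and>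
      (\<forall>v\<in>carrier V. \<forall>as\<in>tuples A (n - 1). \<forall>a\<in>carrier A.
        d n n (t v (as @ [a])) = t (lact a v) (map \<alpha> as)))"

end

theory Submission
  imports Defs
begin

text \<open>
  The tensor product $V \otimes A^{\otimes n}$ is a quotient of a free module, so linear maps on it
  correspond to multilinear maps of tuples. Each face formula is multilinear, which gives existence.
  Two linear maps that agree on pure tensors are equal, so the presimplicial identities need to be
  checked on pure tensors only. When the two operations do not touch a common factor, the identity is
  multiplicativity of $\alpha$ or compatibility of $\beta$ with the actions; when they overlap, it is
  one of the Hom-associativity axioms of $A$ and $V$.
\<close>

section \<open>Linear maps\<close>

text \<open>Place v, a_1, ..., a_n on a circle. Each face multiplies two neighbours and twists all
  other factors, by \<alpha> in \<open>A\<close> and by \<beta> in \<open>V\<close>. Two faces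
  overlap when they share a factor, and the three neighbours involved select the axiom: (v, a_1,
  a_2) gives \<open>right_module\<close>, (a_n, v, a_1) gives \<open>bimodule\<close>, (a_{n-1},
  a_n, v) gives \<open>left_module\<close>, and three neighbours inside \<open>A\<close> give
  \<open>hom_assoc\<close>. If no factor is shared, one order of the faces twists a product while
  the other multiplies twisted factors; \<open>alpha_mult\<close>, \<open>beta_ract\<close> and
  \<open>beta_lact\<close> say that this makes no difference.

  Functions in HOL are total, so a linear map is determined on its carrier only, and \<delta> is
  further unconstrained for indices outside 1 \<le> n, i \<le> n. Hence \<delta> is not literally
  unique: existence is shown separately, and the identities are proved for every \<delta> that
  satisfies the formulas.\<close>

lemma linear_mapsI:
  assumes "\<And>x. x \<in> carrier M \<Longrightarrow> f x \<in> carrier N"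
    and "\<And>x y. \<lbrakk>x \<in> carrier M; y \<in> carrier M\<rbrakk> \<Longrightarrow> f (x \<oplus>\<^bsub>M\<^esub> y) = f x \<oplus>\<^bsub>N\<^esub> f y"
    and "\<And>c x. \<lbrakk>c \<in> carrier K; x \<in> carrier M\<rbrakk> \<Longrightarrow> f (c \<odot>\<^bsub>M\<^esub> x) = c \<odot>\<^bsub>N\<^esub> f x"
  shows "f \<in> linear_maps K M N"
  using assms by (simp add: linear_maps_def)

lemma linear_mapsD:
  assumes "f \<in> linear_maps K M N"
  shows linear_maps_closed: "x \<in> carrier M \<Longrightarrow> f x \<in> carrier N"
    and linear_maps_add:
      "\<lbrakk>x \<in> carrier M; y \<in> carrier M\<rbrakk> \<Longrightarrow> f (x \<oplus>\<^bsub>M\<^esub> y) = f x \<oplus>\<^bsub>N\<^esub> f y"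
    and linear_maps_smult:
      "\<lbrakk>c \<in> carrier K; x \<in> carrier M\<rbrakk> \<Longrightarrow> f (c \<odot>\<^bsub>M\<^esub> x) = c \<odot>\<^bsub>N\<^esub> f x"
  using assms by (auto simp: linear_maps_def)

lemma linear_maps_compose:
  assumes "f \<in> linear_maps K M N" and "g \<in> linear_maps K N P"
  shows "(\<lambda>x. g (f x)) \<in> linear_maps K M P"
  using linear_mapsD[OF assms(1)] linear_mapsD[OF assms(2)] by (intro linear_mapsI) simp_all

lemma linear_maps_minus:
  assumes "module K M" and "module K N" and f: "f \<in> linear_maps K M N"
    and x: "x \<in> carrier M" and y: "y \<in> carrier M"
  shows "f (x \<ominus>\<^bsub>M\<^esub> y) = f x \<ominus>\<^bsub>N\<^esub> f y"
proof -
  interpret M: module K M by fact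
  interpret N: module K N by fact
  note D = linear_mapsD[OF f]
  have "f (x \<ominus>\<^bsub>M\<^esub> y) \<oplus>\<^bsub>N\<^esub> f y = f x"
    using x y by (simp add: D(2)[symmetric] M.minus_eq M.a_assoc M.l_neg)
  with x y show ?thesis
    by (metis D(1) M.minus_closed N.add.inv_solve_right N.minus_eq)
qed

text \<open>Serves both halves of the universal property. With the zero map for \<open>g\<close> it
  is a kernel, which contains all of \<open>tensor_null\<close> once it contains the relations; with
  two arbitrary maps it reduces their equality to generators.\<close>

lemma linear_maps_equalizer:
  assumes "module K M" and "module K N"
    and f: "f \<in> linear_maps K M N" and g: "g \<in> linear_maps K M N"
  shows "submodule {x \<in> carrier M. f x = g x} K M"
proof -
  interpret M: module K M by fact
  interpret N: module K N by fact
  have zero: "h \<zero>\<^bsub>M\<^esub> = \<zero>\<^bsub>N\<^esub>" if "h \<in> linear_maps K M N" for h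
    using linear_maps_add[OF that, of "\<zero>\<^bsub>M\<^esub>" "\<zero>\<^bsub>M\<^esub>"] linear_maps_closed[OF that, of "\<zero>\<^bsub>M\<^esub>"]
    by (metis M.l_zero M.zero_closed N.add.r_cancel_one')
  have neg: "h (\<ominus>\<^bsub>M\<^esub> x) = \<ominus>\<^bsub>N\<^esub> h x" if "h \<in> linear_maps K M N" "x \<in> carrier M" for h x
    using linear_maps_minus[OF assms(1,2) that(1), of "\<zero>\<^bsub>M\<^esub>" x] linear_mapsD(1)[OF that(1)] that(2)
    by (simp add: M.minus_eq N.minus_eq zero[OF that(1)])
  show ?thesis
    by (rule M.submoduleI)
      (auto simp: zero f g neg linear_maps_add[OF f] linear_maps_add[OF g]
        linear_maps_smult[OF f] linear_maps_smult[OF g])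
qed

text \<open>The hull is an intersection of submodules. Because \<open>X\<close> lies in the carrier,
  the carrier is itself a member of the family, so the intersection stays inside
  \<open>M\<close>.\<close>

lemma submodule_hull:
  assumes "module K M" and "X \<subseteq> carrier M"
  shows "submodule ((\<lambda>H. submodule H K M) hull X) K M"
proof -
  interpret M: module K M by fact
  have "(\<lambda>H. submodule H K M) hull X \<subseteq> carrier M"
    by (intro hull_minimal assms(2) M.carrier_is_submodule)
  then show ?thesis
  proof (rule M.submoduleI)
    show "\<zero>\<^bsub>M\<^esub> \<in> (\<lambda>H. submodule H K M) hull X"
      by (auto simp: hull_def dest!: submodule.axioms(1) subgroup.one_closed)
  qed (auto simp: hull_def M.submoduleE)
qed


section \<open>Free modules\<close>

lemma free_module_simps:
  "carrier (free_module K S) =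
    {f. range f \<subseteq> carrier K \<and> {s. f s \<noteq> \<zero>\<^bsub>K\<^esub>} \<subseteq> S \<and> finite {s. f s \<noteq> \<zero>\<^bsub>K\<^esub>}}"
  "\<zero>\<^bsub>free_module K S\<^esub> = (\<lambda>s. \<zero>\<^bsub>K\<^esub>)"
  "f \<oplus>\<^bsub>free_module K S\<^esub> g = (\<lambda>s. f s \<oplus>\<^bsub>K\<^esub> g s)"
  "c \<odot>\<^bsub>free_module K S\<^esub> f = (\<lambda>s. c \<otimes>\<^bsub>K\<^esub> f s)"
  by (simp_all add: free_module_def)

context cring
begin

text \<open>The support of \<open>h\<close> lies in the union of two finite supports. Taking
  \<open>g\<close> equal to \<open>f\<close> covers unary operations such as negation, scaling and
  deleting one value.\<close>

lemma free_module_closed_pointwise: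
  assumes "f \<in> carrier (free_module R S)" "g \<in> carrier (free_module R S)"
    and "\<And>s. h s \<in> carrier R" and "\<And>s. \<lbrakk>f s = \<zero>; g s = \<zero>\<rbrakk> \<Longrightarrow> h s = \<zero>"
  shows "h \<in> carrier (free_module R S)"
proof -
  have "{s. h s \<noteq> \<zero>} \<subseteq> {s. f s \<noteq> \<zero>} \<union> {s. g s \<noteq> \<zero>}" using assms(4) by auto
  then show ?thesis using assms(1-3)
    by (auto simp: free_module_simps intro: finite_subset)
qed

lemma module_free_module: "module R (free_module R S)" (is "module R ?F")
proof -
  have c: "f s \<in> carrier R" if "f \<in> carrier ?F" for f s
    using that by (auto simp: free_module_simps)
  note pw = free_module_closed_pointwise
  show ?thesis
  proof (rule moduleI)
    show "abelian_group ?F"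
    proof (rule abelian_groupI)
      fix f g assume "f \<in> carrier ?F" "g \<in> carrier ?F"
      then show "f \<oplus>\<^bsub>?F\<^esub> g \<in> carrier ?F" by (rule pw) (auto simp: free_module_simps(3) c \<open>f \<in> _\<close> \<open>g \<in> _\<close>)
    next
      fix f assume f: "f \<in> carrier ?F"
      have "(\<lambda>s. \<ominus> f s) \<in> carrier ?F" by (rule pw[OF f f]) (auto simp: c f)
      moreover have "(\<lambda>s. \<ominus> f s) \<oplus>\<^bsub>?F\<^esub> f = \<zero>\<^bsub>?F\<^esub>" by (simp add: free_module_simps(2,3) c f l_neg)
      ultimately show "\<exists>g\<in>carrier ?F. g \<oplus>\<^bsub>?F\<^esub> f = \<zero>\<^bsub>?F\<^esub>" by blast
    qed (auto simp: free_module_simps(2,3) c a_ac, simp add: free_module_simps)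
    fix a f assume af: "a \<in> carrier R" "f \<in> carrier ?F"
    show "a \<odot>\<^bsub>?F\<^esub> f \<in> carrier ?F"
      unfolding free_module_simps(4) by (rule pw[OF af(2) af(2)]) (auto simp: c af)
  qed (simp_all add: free_module_simps(3,4) c l_distr r_distr m_assoc is_cring)
qed

lemma free_gen_closed: "s \<in> S \<Longrightarrow> free_gen R s \<in> carrier (free_module R S)"
  by (auto simp: free_module_simps free_gen_def intro: finite_subset[of _ "{s}"])

text \<open>Induction on a finite set containing the support, splitting off one generator at a
  time.\<close>

lemma free_module_generated:
  assumes H: "submodule H R (free_module R S)" and gen: "\<And>s. s \<in> S \<Longrightarrow> free_gen R s \<in> H"
    and f: "f \<in> carrier (free_module R S)"
  shows "f \<in> H"
proof -
  interpret F: module R "free_module R S" by (rule module_free_module)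
  note E = F.submoduleE[OF H]
  have "\<forall>f\<in>carrier (free_module R S). {s. f s \<noteq> \<zero>} \<subseteq> X \<longrightarrow> f \<in> H" if "finite X" for X
    using that
  proof (induction X)
    case empty
    have "\<zero>\<^bsub>free_module R S\<^esub> \<in> H"
      using subgroup.one_closed[OF submodule.axioms(1)[OF H]] by simp
    moreover have "f = \<zero>\<^bsub>free_module R S\<^esub>" if "{s. f s \<noteq> \<zero>} \<subseteq> {}" for f
      using that by (auto simp: free_module_simps)
    ultimately show ?case by metis
  next
    case (insert x X)
    show ?case
    proof (intro ballI impI)
      fix f assume f: "f \<in> carrier (free_module R S)" and sub: "{s. f s \<noteq> \<zero>} \<subseteq> insert x X"
      have fc: "f s \<in> carrier R" for s using f by (auto simp: free_module_simps)
      \<comment> \<open>Deleting the value at \<open>x\<close> moves the support into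
        \<open>X\<close>, and \<open>f\<close> is recovered as \<open>f x\<close> times the
        generator at \<open>x\<close>, plus \<open>g\<close>.\<close>
      define g where "g = f(x := \<zero>)"
      have g: "g \<in> carrier (free_module R S)"
        by (rule free_module_closed_pointwise[OF f f]) (auto simp: g_def fc)
      have "{s. g s \<noteq> \<zero>} \<subseteq> X" using sub by (auto simp: g_def)
      then have gH: "g \<in> H" using insert.IH g by blast
      show "f \<in> H"
      proof (cases "f x = \<zero>")
        case True
        then have "f = g" by (auto simp: g_def)
        then show ?thesis using gH by simp
      next
        case False
        then have "x \<in> S" using f by (auto simp: free_module_simps)
        then have "f x \<odot>\<^bsub>free_module R S\<^esub> free_gen R x \<oplus>\<^bsub>free_module R S\<^esub> g \<in> H"
          by (intro E(4,5) gen gH fc)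
        also have "f x \<odot>\<^bsub>free_module R S\<^esub> free_gen R x \<oplus>\<^bsub>free_module R S\<^esub> g = f"
          by (auto simp: free_module_simps(3,4) free_gen_def g_def fc)
        finally show ?thesis .
      qed
    qed
  qed
  then show ?thesis using f by (auto simp: free_module_simps)
qed

end

text \<open>The linear extension of \<phi> from the generators. Summing over the support of
  \<open>f\<close> keeps the index set finite even when the generating set is infinite.\<close>

definition free_lift ::
    "('k, 'r) ring_scheme \<Rightarrow> ('k, 'p, 'm) module_scheme \<Rightarrow> ('s \<Rightarrow> 'p) \<Rightarrow> ('s \<Rightarrow> 'k) \<Rightarrow> 'p"
  where "free_lift K P \<phi> f = (\<Oplus>\<^bsub>P\<^esub>s\<in>{s. f s \<noteq> \<zero>\<^bsub>K\<^esub>}. f s \<odot>\<^bsub>P\<^esub> \<phi> s)"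

context module
begin

text \<open>Cancellation can make the support of a sum or of a scalar multiple smaller than
  expected. Extending all sums to one common finite set \<open>X\<close> allows them to be compared
  term by term.\<close>

lemma free_lift_superset:
  assumes "f \<in> carrier (free_module R S)" and "\<phi> \<in> S \<rightarrow> carrier M"
    and "finite X" and "{s. f s \<noteq> \<zero>} \<subseteq> X" and "X \<subseteq> S"
  shows "free_lift R M \<phi> f = (\<Oplus>\<^bsub>M\<^esub>s\<in>X. f s \<odot>\<^bsub>M\<^esub> \<phi> s)"
proof -
  have "f s \<odot>\<^bsub>M\<^esub> \<phi> s \<in> carrier M" if "s \<in> X" for s
    using that assms(1,2,5) by (intro smult_closed) (auto simp: free_module_simps)
  moreover have "f s \<odot>\<^bsub>M\<^esub> \<phi> s = \<zero>\<^bsub>M\<^esub>" if "s \<in> X" "f s = \<zero>" for s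
    using that assms(2,5) by (metis Pi_iff smult_l_null subsetD)
  ultimately show ?thesis
    unfolding free_lift_def using assms(3,4)
    by (intro M.add.finprod_mono_neutral_cong_left) auto
qed

lemma free_lift_linear:
  assumes \<phi>: "\<phi> \<in> S \<rightarrow> carrier M"
  shows "free_lift R M \<phi> \<in> linear_maps R (free_module R S) M"
proof (rule linear_mapsI)
  interpret F: module R "free_module R S" by (rule module_free_module)
  fix f assume f: "f \<in> carrier (free_module R S)"
  have fc: "h s \<in> carrier R" if "h \<in> carrier (free_module R S)" for h s
    using that by (auto simp: free_module_simps)
  have fS: "{s. h s \<noteq> \<zero>} \<subseteq> S" and ff: "finite {s. h s \<noteq> \<zero>}"
    if "h \<in> carrier (free_module R S)" for h
    using that by (auto simp: free_module_simps)
  have \<phi>c: "s \<in> S \<Longrightarrow> \<phi> s \<in> carrier M" for s using \<phi> by auto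
  show "free_lift R M \<phi> f \<in> carrier M"
    unfolding free_lift_def using f fS[OF f] by (intro M.finsum_closed) (auto simp: fc \<phi>c)
  {
    fix g assume g: "g \<in> carrier (free_module R S)"
    define X where "X = {s. f s \<noteq> \<zero>} \<union> {s. g s \<noteq> \<zero>}"
    have X: "finite X" "X \<subseteq> S" using f g fS ff by (auto simp: X_def)
    have sub: "{s. (f \<oplus>\<^bsub>free_module R S\<^esub> g) s \<noteq> \<zero>} \<subseteq> X"
      by (auto simp: X_def free_module_simps)
    have "free_lift R M \<phi> (f \<oplus>\<^bsub>free_module R S\<^esub> g)
        = (\<Oplus>\<^bsub>M\<^esub>s\<in>X. (f \<oplus>\<^bsub>free_module R S\<^esub> g) s \<odot>\<^bsub>M\<^esub> \<phi> s)"
      by (rule free_lift_superset[OF F.a_closed[OF f g] \<phi> X(1) sub X(2)])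
    also have "\<dots> = (\<Oplus>\<^bsub>M\<^esub>s\<in>X. f s \<odot>\<^bsub>M\<^esub> \<phi> s \<oplus>\<^bsub>M\<^esub> g s \<odot>\<^bsub>M\<^esub> \<phi> s)"
      using X(2) by (intro M.finsum_cong') (auto simp: free_module_simps(3) smult_l_distr fc f g \<phi>c subset_iff)
    also have "\<dots> = (\<Oplus>\<^bsub>M\<^esub>s\<in>X. f s \<odot>\<^bsub>M\<^esub> \<phi> s) \<oplus>\<^bsub>M\<^esub> (\<Oplus>\<^bsub>M\<^esub>s\<in>X. g s \<odot>\<^bsub>M\<^esub> \<phi> s)"
      using X(2) by (intro M.finsum_addf) (auto simp: fc f g \<phi>c subset_iff)
    also have "\<dots> = free_lift R M \<phi> f \<oplus>\<^bsub>M\<^esub> free_lift R M \<phi> g"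
      using X by (subst (1 2) free_lift_superset[OF _ \<phi>, of _ X]) (auto simp: f g X_def)
    finally show "free_lift R M \<phi> (f \<oplus>\<^bsub>free_module R S\<^esub> g) = free_lift R M \<phi> f \<oplus>\<^bsub>M\<^esub> free_lift R M \<phi> g" .
  }
  fix c assume c: "c \<in> carrier R"
  define X where "X = {s. f s \<noteq> \<zero>}"
  have X: "finite X" "X \<subseteq> S" using f fS ff by (auto simp: X_def)
  have sub: "{s. (c \<odot>\<^bsub>free_module R S\<^esub> f) s \<noteq> \<zero>} \<subseteq> X"
    using c by (auto simp: X_def free_module_simps)
  have "free_lift R M \<phi> (c \<odot>\<^bsub>free_module R S\<^esub> f)
      = (\<Oplus>\<^bsub>M\<^esub>s\<in>X. (c \<odot>\<^bsub>free_module R S\<^esub> f) s \<odot>\<^bsub>M\<^esub> \<phi> s)"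
    by (rule free_lift_superset[OF F.smult_closed[OF c f] \<phi> X(1) sub X(2)])
  also have "\<dots> = (\<Oplus>\<^bsub>M\<^esub>s\<in>X. c \<odot>\<^bsub>M\<^esub> (f s \<odot>\<^bsub>M\<^esub> \<phi> s))"
    using X(2) by (intro M.finsum_cong') (auto simp: free_module_simps(4) smult_assoc1 fc f c \<phi>c subset_iff)
  also have "\<dots> = c \<odot>\<^bsub>M\<^esub> free_lift R M \<phi> f"
    unfolding free_lift_def X_def[symmetric] using X
    by (subst finsum_smult_ldistr) (auto simp: fc f c \<phi>c)
  finally show "free_lift R M \<phi> (c \<odot>\<^bsub>free_module R S\<^esub> f) = c \<odot>\<^bsub>M\<^esub> free_lift R M \<phi> f" .
qed

lemma free_lift_gen:
  assumes "\<phi> \<in> S \<rightarrow> carrier M" and "s \<in> S"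
  shows "free_lift R M \<phi> (free_gen R s) = \<phi> s"
proof -
  have "free_lift R M \<phi> (free_gen R s) = (\<Oplus>\<^bsub>M\<^esub>t\<in>{s}. free_gen R s t \<odot>\<^bsub>M\<^esub> \<phi> t)"
    using assms by (intro free_lift_superset[of _ S] free_gen_closed) (auto simp: free_gen_def)
  moreover have "\<phi> s \<in> carrier M" using assms by auto
  ultimately show ?thesis by (simp add: free_gen_def M.finsum_insert)
qed

end


section \<open>Quotient modules\<close>

lemma quotient_module_simps:
  "carrier (quotient_module M N) = a_rcosets\<^bsub>M\<^esub> N"
  "\<zero>\<^bsub>quotient_module M N\<^esub> = N"
  "X \<oplus>\<^bsub>quotient_module M N\<^esub> Y = X <+>\<^bsub>M\<^esub> Y"
  "c \<odot>\<^bsub>quotient_module M N\<^esub> X = (\<Union>x\<in>X. N +>\<^bsub>M\<^esub> (c \<odot>\<^bsub>M\<^esub> x))"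
  by (simp_all add: quotient_module_def)

text \<open>Evaluates \<open>f\<close> at an arbitrarily chosen element of the coset. This is
  meaningful only when \<open>f\<close> is constant on cosets, that is, when it vanishes on the
  submodule.\<close>

definition quotient_lift :: "('a \<Rightarrow> 'b) \<Rightarrow> 'a set \<Rightarrow> 'b"
  where "quotient_lift f X = f (SOME x. x \<in> X)"

context module
begin

lemma submodule_abelian_subgroup: "submodule N R M \<Longrightarrow> abelian_subgroup N M"
  by (rule abelian_subgroupI3[OF additive_subgroupI[OF submodule.axioms(1)] M.abelian_group_axioms])

lemma coset_eq_iff:
  assumes "submodule N R M" and "x \<in> carrier M" and "y \<in> carrier M"
  shows "N +>\<^bsub>M\<^esub> x = N +>\<^bsub>M\<^esub> y \<longleftrightarrow> x \<ominus>\<^bsub>M\<^esub> y \<in> N"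
proof -
  interpret N: abelian_subgroup N M by (rule submodule_abelian_subgroup[OF assms(1)])
  have "N +>\<^bsub>M\<^esub> x = N +>\<^bsub>M\<^esub> y \<longleftrightarrow> x \<in> N +>\<^bsub>M\<^esub> y"
    using N.a_repr_independence'[OF _ assms(3)] N.a_rcos_self[OF assms(2)] by auto
  also have "\<dots> \<longleftrightarrow> x \<ominus>\<^bsub>M\<^esub> y \<in> N"
    using N.a_rcos_module[OF assms(3,2)] by (simp add: M.minus_eq)
  finally show ?thesis .
qed

lemma quotient_carrierE:
  assumes "X \<in> carrier (quotient_module M N)"
  obtains x where "x \<in> carrier M" and "X = N +>\<^bsub>M\<^esub> x"
  using assms unfolding quotient_module_simps A_RCOSETS_def' by blast

lemma quotient_add:
  assumes "submodule N R M" and "x \<in> carrier M" and "y \<in> carrier M"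
  shows "(N +>\<^bsub>M\<^esub> x) \<oplus>\<^bsub>quotient_module M N\<^esub> (N +>\<^bsub>M\<^esub> y) = N +>\<^bsub>M\<^esub> (x \<oplus>\<^bsub>M\<^esub> y)"
  using abelian_subgroup.a_rcos_sum[OF submodule_abelian_subgroup[OF assms(1)] assms(2,3)]
  by (simp add: quotient_module_simps)

text \<open>For \<open>y\<close> in the coset of \<open>x\<close>, the element c(y - x) lies in
  \<open>N\<close>, so all cosets in the union defining the scalar multiple coincide.\<close>

lemma quotient_smult:
  assumes N: "submodule N R M" and c: "c \<in> carrier R" and x: "x \<in> carrier M"
  shows "c \<odot>\<^bsub>quotient_module M N\<^esub> (N +>\<^bsub>M\<^esub> x) = N +>\<^bsub>M\<^esub> (c \<odot>\<^bsub>M\<^esub> x)"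
proof -
  interpret N: abelian_subgroup N M by (rule submodule_abelian_subgroup[OF N])
  have "N +>\<^bsub>M\<^esub> (c \<odot>\<^bsub>M\<^esub> y) = N +>\<^bsub>M\<^esub> (c \<odot>\<^bsub>M\<^esub> x)" if y: "y \<in> N +>\<^bsub>M\<^esub> x" for y
  proof -
    have yc: "y \<in> carrier M" by (rule N.a_elemrcos_carrier[OF x y])
    have "c \<odot>\<^bsub>M\<^esub> (y \<ominus>\<^bsub>M\<^esub> x) \<in> N"
      using N.a_rcos_module[OF x yc] y submoduleE(4)[OF N c] by (simp add: M.minus_eq)
    then have "c \<odot>\<^bsub>M\<^esub> y \<ominus>\<^bsub>M\<^esub> c \<odot>\<^bsub>M\<^esub> x \<in> N"
      using c x yc by (simp add: M.minus_eq smult_r_distr smult_r_minus)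
    then show ?thesis using coset_eq_iff[OF N] c x yc by simp
  qed
  then show ?thesis using N.a_rcos_self[OF x] unfolding quotient_module_simps(4) by blast
qed

lemma coset_closed:
  "submodule N R M \<Longrightarrow> x \<in> carrier M \<Longrightarrow> N +>\<^bsub>M\<^esub> x \<in> carrier (quotient_module M N)"
  by (simp add: quotient_module_simps M.a_rcosetsI submoduleE(1))

lemma coset_linear:
  assumes "submodule N R M"
  shows "(\<lambda>x. N +>\<^bsub>M\<^esub> x) \<in> linear_maps R M (quotient_module M N)"
  by (rule linear_mapsI) (simp_all only: coset_closed quotient_add quotient_smult assms)

lemma module_quotient_module:
  assumes N: "submodule N R M"
  shows "module R (quotient_module M N)" (is "module R ?Q")
proof -
  note [simp] = quotient_add[OF N] quotient_smult[OF N] coset_closed[OF N]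
  \<comment> \<open>As a coset of a representative, the zero falls under \<open>quotient_add\<close>
    like any other element.\<close>
  have zero: "\<zero>\<^bsub>?Q\<^esub> = N +>\<^bsub>M\<^esub> \<zero>\<^bsub>M\<^esub>"
    by (simp add: quotient_module_simps submoduleE(1)[OF N])
  show ?thesis
  proof (rule moduleI)
    show "abelian_group ?Q"
    proof (rule abelian_groupI)
      fix X assume "X \<in> carrier ?Q"
      then obtain x where x: "x \<in> carrier M" "X = N +>\<^bsub>M\<^esub> x" by (rule quotient_carrierE)
      show "\<zero>\<^bsub>?Q\<^esub> \<oplus>\<^bsub>?Q\<^esub> X = X" using x by (simp add: zero)
      have "(N +>\<^bsub>M\<^esub> \<ominus>\<^bsub>M\<^esub> x) \<oplus>\<^bsub>?Q\<^esub> X = \<zero>\<^bsub>?Q\<^esub>" using x by (simp add: zero M.l_neg)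
      moreover have "N +>\<^bsub>M\<^esub> \<ominus>\<^bsub>M\<^esub> x \<in> carrier ?Q" using x by simp
      ultimately show "\<exists>Y\<in>carrier ?Q. Y \<oplus>\<^bsub>?Q\<^esub> X = \<zero>\<^bsub>?Q\<^esub>" by blast
      fix Y assume "Y \<in> carrier ?Q"
      then obtain y where y: "y \<in> carrier M" "Y = N +>\<^bsub>M\<^esub> y" by (rule quotient_carrierE)
      show "X \<oplus>\<^bsub>?Q\<^esub> Y \<in> carrier ?Q" using x y by simp
      show "X \<oplus>\<^bsub>?Q\<^esub> Y = Y \<oplus>\<^bsub>?Q\<^esub> X" using x y by (simp add: M.a_comm)
      fix Z assume "Z \<in> carrier ?Q"
      then obtain z where z: "z \<in> carrier M" "Z = N +>\<^bsub>M\<^esub> z" by (rule quotient_carrierE)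
      show "(X \<oplus>\<^bsub>?Q\<^esub> Y) \<oplus>\<^bsub>?Q\<^esub> Z = X \<oplus>\<^bsub>?Q\<^esub> (Y \<oplus>\<^bsub>?Q\<^esub> Z)" using x y z by (simp add: M.a_assoc)
    qed (simp add: zero)
  next
    fix X assume "X \<in> carrier ?Q"
    then show "\<one> \<odot>\<^bsub>?Q\<^esub> X = X" by (elim quotient_carrierE) simp
  next
    fix a X assume a: "a \<in> carrier R" and "X \<in> carrier ?Q"
    then obtain x where x: "x \<in> carrier M" "X = N +>\<^bsub>M\<^esub> x" by (elim quotient_carrierE)
    show "a \<odot>\<^bsub>?Q\<^esub> X \<in> carrier ?Q" using a x by simp
    fix b assume b: "b \<in> carrier R"
    show "(a \<oplus> b) \<odot>\<^bsub>?Q\<^esub> X = a \<odot>\<^bsub>?Q\<^esub> X \<oplus>\<^bsub>?Q\<^esub> b \<odot>\<^bsub>?Q\<^esub> X" using a b x by (simp add: smult_l_distr)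
    show "(a \<otimes> b) \<odot>\<^bsub>?Q\<^esub> X = a \<odot>\<^bsub>?Q\<^esub> (b \<odot>\<^bsub>?Q\<^esub> X)" using a b x by (simp add: smult_assoc1)
  next
    fix a X Y assume a: "a \<in> carrier R" and "X \<in> carrier ?Q" "Y \<in> carrier ?Q"
    then obtain x y where "x \<in> carrier M" "X = N +>\<^bsub>M\<^esub> x" "y \<in> carrier M" "Y = N +>\<^bsub>M\<^esub> y"
      by (elim quotient_carrierE)
    then show "a \<odot>\<^bsub>?Q\<^esub> (X \<oplus>\<^bsub>?Q\<^esub> Y) = a \<odot>\<^bsub>?Q\<^esub> X \<oplus>\<^bsub>?Q\<^esub> a \<odot>\<^bsub>?Q\<^esub> Y"
      using a by (simp add: smult_r_distr)
  qed (rule R.is_cring)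
qed

text \<open>The chosen representative differs from \<open>x\<close> by an element of
  \<open>N\<close>, which \<open>f\<close> kills.\<close>

lemma quotient_lift:
  assumes N: "submodule N R M" and P: "module R P" and f: "f \<in> linear_maps R M P"
    and null: "\<And>x. x \<in> N \<Longrightarrow> f x = \<zero>\<^bsub>P\<^esub>" and x: "x \<in> carrier M"
  shows "quotient_lift f (N +>\<^bsub>M\<^esub> x) = f x"
proof -
  interpret N: abelian_subgroup N M by (rule submodule_abelian_subgroup[OF N])
  interpret P: module R P by (rule P)
  define y where "y = (SOME y. y \<in> N +>\<^bsub>M\<^esub> x)"
  have y: "y \<in> N +>\<^bsub>M\<^esub> x" unfolding y_def using N.a_rcos_self[OF x] by (rule someI)
  then have yc: "y \<in> carrier M" by (rule N.a_elemrcos_carrier[OF x])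
  have "f (y \<ominus>\<^bsub>M\<^esub> x) = \<zero>\<^bsub>P\<^esub>"
    using N.a_rcos_module[OF x yc] y by (simp add: M.minus_eq null)
  then have "f y \<oplus>\<^bsub>P\<^esub> \<ominus>\<^bsub>P\<^esub> f x = \<zero>\<^bsub>P\<^esub>"
    using linear_maps_minus[OF module_axioms P f yc x] by (simp add: P.minus_eq)
  then have "f y = f x"
    using P.minus_equality[of "f y" "\<ominus>\<^bsub>P\<^esub> f x"] linear_maps_closed[OF f] yc x by simp
  then show ?thesis by (simp add: quotient_lift_def y_def)
qed

lemma quotient_lift_linear:
  assumes N: "submodule N R M" and "module R P" and f: "f \<in> linear_maps R M P"
    and "\<And>x. x \<in> N \<Longrightarrow> f x = \<zero>\<^bsub>P\<^esub>"
  shows "quotient_lift f \<in> linear_maps R (quotient_module M N) P"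
proof (rule linear_mapsI)
  note [simp] = quotient_lift[OF assms] quotient_add[OF N] quotient_smult[OF N] linear_mapsD[OF f]
  fix X assume "X \<in> carrier (quotient_module M N)"
  then obtain x where x: "x \<in> carrier M" "X = N +>\<^bsub>M\<^esub> x" by (rule quotient_carrierE)
  then show "quotient_lift f X \<in> carrier P" by simp
  show "quotient_lift f (c \<odot>\<^bsub>quotient_module M N\<^esub> X) = c \<odot>\<^bsub>P\<^esub> quotient_lift f X"
    if "c \<in> carrier R" for c
    using that x by simp
  fix Y assume "Y \<in> carrier (quotient_module M N)"
  then obtain y where "y \<in> carrier M" "Y = N +>\<^bsub>M\<^esub> y" by (rule quotient_carrierE)
  then show "quotient_lift f (X \<oplus>\<^bsub>quotient_module M N\<^esub> Y)
      = quotient_lift f X \<oplus>\<^bsub>P\<^esub> quotient_lift f Y"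
    using x by simp
qed

end


section \<open>Universal property of the tensor product\<close>

text \<open>Linearity in slot \<open>j\<close> is phrased by overwriting that entry of a full tuple,
  in the same form as the generators of \<open>tensor_relations\<close>; the old entry there is a
  mere placeholder.\<close>

definition multilinear_maps ::
    "('k, 'r) ring_scheme \<Rightarrow> ('k, 'a, 'm) module_scheme \<Rightarrow> ('k, 'v, 'n) module_scheme \<Rightarrow> nat \<Rightarrow>
      ('k, 'p, 'q) module_scheme \<Rightarrow> ('v \<Rightarrow> 'a list \<Rightarrow> 'p) set"
  where "multilinear_maps K A V n P =
    {\<phi>. (\<forall>as\<in>tuples A n. (\<lambda>v. \<phi> v as) \<in> linear_maps K V P) \<and>
        (\<forall>v\<in>carrier V. \<forall>as\<in>tuples A n. \<forall>j<n. (\<lambda>a. \<phi> v (as[j := a])) \<in> linear_maps K A P)}"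

lemma
  assumes "\<phi> \<in> multilinear_maps K A V n P" and "as \<in> tuples A n"
  shows multilinear_maps_first: "(\<lambda>v. \<phi> v as) \<in> linear_maps K V P"
    and multilinear_maps_update:
      "\<lbrakk>v \<in> carrier V; j < n\<rbrakk> \<Longrightarrow> (\<lambda>a. \<phi> v (as[j := a])) \<in> linear_maps K A P"
  using assms by (simp_all add: multilinear_maps_def)

lemma tuples_update: "\<lbrakk>as \<in> tuples A n; a \<in> carrier A\<rbrakk> \<Longrightarrow> as[j := a] \<in> tuples A n"
  using set_update_subset_insert[of as j a] by (auto simp: tuples_def)

lemma tuples_cases_first:
  assumes "as \<in> tuples A n" and "1 \<le> n"
  obtains a bs where "as = a # bs" and "a \<in> carrier A" and "bs \<in> tuples A (n - 1)"
  using assms by (cases as) (auto simp: tuples_def)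

lemma tuples_cases_last:
  assumes "as \<in> tuples A n" and "1 \<le> n"
  obtains bs a where "as = bs @ [a]" and "bs \<in> tuples A (n - 1)" and "a \<in> carrier A"
  using assms by (cases as rule: rev_cases) (auto simp: tuples_def)

lemma tuples_cases_inner:
  assumes "as \<in> tuples A n" and "1 \<le> i" and "i < n"
  obtains xs a b ys where "as = xs @ a # b # ys" and "xs \<in> tuples A (i - 1)"
    and "a \<in> carrier A" and "b \<in> carrier A" and "ys \<in> tuples A (n - 1 - i)"
proof -
  have len: "length as = n" and set: "set as \<subseteq> carrier A" using assms(1) by (auto simp: tuples_def)
  \<comment> \<open>Lists are indexed from 0, so the factors a_i and a_{i+1} are the entries
    \<open>i - 1\<close> and \<open>i\<close>.\<close>
  have split: "as = take (i - 1) as @ as ! (i - 1) # as ! i # drop (i + 1) as"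
    using assms(2,3) len id_take_nth_drop[of "i - 1" as] Cons_nth_drop_Suc[of i as] by simp
  show thesis
  proof (rule that[OF split])
    show "take (i - 1) as \<in> tuples A (i - 1)" "drop (i + 1) as \<in> tuples A (n - 1 - i)"
      using assms(2,3) len set set_take_subset[of "i - 1" as] set_drop_subset[of "i + 1" as]
      by (auto simp: tuples_def)
    show "as ! (i - 1) \<in> carrier A" "as ! i \<in> carrier A"
      using assms(2,3) len set by (auto intro!: subsetD[OF set] nth_mem)
  qed
qed

text \<open>The tensor product and its universal property depend only on the two module structures;
  the Hom data enter later through a sublocale.\<close>

locale two_modules = A: module K A + V: module K V
  for K :: "('k, 'r) ring_scheme" and A :: "('k, 'a, 'm) module_scheme"
    and V :: "('k, 'v, 'n) module_scheme"
begin

lemma module_tensor_free: "module K (tensor_free K V A n)"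
  by (simp add: tensor_free_def A.module_free_module)

lemma tensor_gen_closed:
  "\<lbrakk>v \<in> carrier V; as \<in> tuples A n\<rbrakk> \<Longrightarrow> free_gen K (v, as) \<in> carrier (tensor_free K V A n)"
  by (simp add: tensor_free_def A.free_gen_closed)

lemma tensor_relationsE:
  assumes "r \<in> tensor_relations K V A n"
  obtains
    (add) v w as where "v \<in> carrier V" "w \<in> carrier V" "as \<in> tuples A n"
      "r = free_gen K (v \<oplus>\<^bsub>V\<^esub> w, as) \<ominus>\<^bsub>tensor_free K V A n\<^esub>
        (free_gen K (v, as) \<oplus>\<^bsub>tensor_free K V A n\<^esub> free_gen K (w, as))"
  | (smult) c v as where "c \<in> carrier K" "v \<in> carrier V" "as \<in> tuples A n"
      "r = free_gen K (c \<odot>\<^bsub>V\<^esub> v, as) \<ominus>\<^bsub>tensor_free K V A n\<^esub>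
        c \<odot>\<^bsub>tensor_free K V A n\<^esub> free_gen K (v, as)"
  | (add_update) v as j a b where "v \<in> carrier V" "as \<in> tuples A n" "j < n" "a \<in> carrier A" "b \<in> carrier A"
      "r = free_gen K (v, as[j := a \<oplus>\<^bsub>A\<^esub> b]) \<ominus>\<^bsub>tensor_free K V A n\<^esub>
        (free_gen K (v, as[j := a]) \<oplus>\<^bsub>tensor_free K V A n\<^esub> free_gen K (v, as[j := b]))"
  | (smult_update) v as j c a where "v \<in> carrier V" "as \<in> tuples A n" "j < n" "c \<in> carrier K" "a \<in> carrier A"
      "r = free_gen K (v, as[j := c \<odot>\<^bsub>A\<^esub> a]) \<ominus>\<^bsub>tensor_free K V A n\<^esub>
        c \<odot>\<^bsub>tensor_free K V A n\<^esub> free_gen K (v, as[j := a])"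
  using assms unfolding tensor_relations_def Let_def
  by (elim UnE CollectE exE conjE) (rule that; assumption)+

lemma tensor_relations_closed: "tensor_relations K V A n \<subseteq> carrier (tensor_free K V A n)"
proof
  interpret F: module K "tensor_free K V A n" by (rule module_tensor_free)
  fix r assume "r \<in> tensor_relations K V A n"
  then show "r \<in> carrier (tensor_free K V A n)"
    by (cases rule: tensor_relationsE) (simp_all add: tensor_gen_closed tuples_update)
qed

lemma submodule_tensor_null: "submodule (tensor_null K V A n) K (tensor_free K V A n)"
  unfolding tensor_null_def by (rule submodule_hull[OF module_tensor_free tensor_relations_closed])

lemma tensor_relations_null: "r \<in> tensor_relations K V A n \<Longrightarrow> r \<in> tensor_null K V A n"
  unfolding tensor_null_def by (rule hull_inc)

lemma module_C_Hom: "module K (C_Hom K A V n)"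
  unfolding C_Hom_def
  by (rule module.module_quotient_module[OF module_tensor_free submodule_tensor_null])

lemma pure_tensor_eq:
  "as \<in> tuples A n \<Longrightarrow>
    pure_tensor K A V v as = tensor_null K V A n +>\<^bsub>tensor_free K V A n\<^esub> free_gen K (v, as)"
  by (simp add: pure_tensor_def tuples_def)

lemma pure_tensor_closed:
  "\<lbrakk>v \<in> carrier V; as \<in> tuples A n\<rbrakk> \<Longrightarrow> pure_tensor K A V v as \<in> carrier (C_Hom K A V n)"
  unfolding C_Hom_def pure_tensor_eq
  by (intro module.coset_closed[OF module_tensor_free submodule_tensor_null] tensor_gen_closed)

text \<open>The generators of \<open>tensor_null\<close> are precisely the differences that
  multilinearity requires to vanish. The function \<open>pure_tensor\<close> reads the degree off
  the length of its list, so one function serves every \<open>n\<close>.\<close>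

lemma pure_tensor_multilinear:
  "pure_tensor K A V \<in> multilinear_maps K A V n (C_Hom K A V n)"
proof -
  let ?F = "tensor_free K V A n" and ?N = "tensor_null K V A n" and ?C = "C_Hom K A V n"
  interpret F: module K ?F by (rule module_tensor_free)
  note N = submodule_tensor_null[of n]
  have eq: "?N +>\<^bsub>?F\<^esub> x = ?N +>\<^bsub>?F\<^esub> y"
    if "x \<ominus>\<^bsub>?F\<^esub> y \<in> tensor_relations K V A n" "x \<in> carrier ?F" "y \<in> carrier ?F" for x y
    using F.coset_eq_iff[OF N that(2,3)] tensor_relations_null[OF that(1)] by simp
  have add: "?N +>\<^bsub>?F\<^esub> x = (?N +>\<^bsub>?F\<^esub> y) \<oplus>\<^bsub>?C\<^esub> (?N +>\<^bsub>?F\<^esub> z)"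
    if "x \<ominus>\<^bsub>?F\<^esub> (y \<oplus>\<^bsub>?F\<^esub> z) \<in> tensor_relations K V A n"
      "x \<in> carrier ?F" "y \<in> carrier ?F" "z \<in> carrier ?F" for x y z
    using eq[OF that(1,2)] F.quotient_add[OF N] that(3,4) by (simp add: C_Hom_def)
  have smult: "?N +>\<^bsub>?F\<^esub> x = c \<odot>\<^bsub>?C\<^esub> (?N +>\<^bsub>?F\<^esub> y)"
    if "x \<ominus>\<^bsub>?F\<^esub> c \<odot>\<^bsub>?F\<^esub> y \<in> tensor_relations K V A n"
      "x \<in> carrier ?F" "c \<in> carrier K" "y \<in> carrier ?F" for c x y
    using eq[OF that(1,2)] F.quotient_smult[OF N that(3,4)] that(3,4) by (simp add: C_Hom_def)
  show ?thesis
    unfolding multilinear_maps_def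
  proof (intro CollectI conjI ballI allI impI)
    fix as assume as: "as \<in> tuples A n"
    show "(\<lambda>v. pure_tensor K A V v as) \<in> linear_maps K V ?C"
    proof (rule linear_mapsI)
      fix v w assume "v \<in> carrier V" "w \<in> carrier V"
      then show "pure_tensor K A V (v \<oplus>\<^bsub>V\<^esub> w) as
          = pure_tensor K A V v as \<oplus>\<^bsub>?C\<^esub> pure_tensor K A V w as"
        using as unfolding pure_tensor_eq[OF as]
        by (intro add tensor_gen_closed V.M.a_closed) (auto simp: tensor_relations_def Let_def)
    next
      fix c v assume "c \<in> carrier K" "v \<in> carrier V"
      then show "pure_tensor K A V (c \<odot>\<^bsub>V\<^esub> v) as = c \<odot>\<^bsub>?C\<^esub> pure_tensor K A V v as"
        using as unfolding pure_tensor_eq[OF as]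
        by (intro smult tensor_gen_closed V.smult_closed) (auto simp: tensor_relations_def Let_def)
    qed (rule pure_tensor_closed[OF _ as])
    fix v j assume v: "v \<in> carrier V" and j: "j < n"
    note upd = tuples_update[OF as, of _ j]
    show "(\<lambda>a. pure_tensor K A V v (as[j := a])) \<in> linear_maps K A ?C"
    proof (rule linear_mapsI)
      fix a b assume a: "a \<in> carrier A" and b: "b \<in> carrier A"
      have ab: "a \<oplus>\<^bsub>A\<^esub> b \<in> carrier A" using a b by simp
      have "free_gen K (v, as[j := a \<oplus>\<^bsub>A\<^esub> b]) \<ominus>\<^bsub>?F\<^esub> (free_gen K (v, as[j := a]) \<oplus>\<^bsub>?F\<^esub> free_gen K (v, as[j := b]))
          \<in> tensor_relations K V A n"
        using as v j a b unfolding tensor_relations_def Let_def by blast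
      then show "pure_tensor K A V v (as[j := a \<oplus>\<^bsub>A\<^esub> b])
          = pure_tensor K A V v (as[j := a]) \<oplus>\<^bsub>?C\<^esub> pure_tensor K A V v (as[j := b])"
        unfolding pure_tensor_eq[OF upd[OF a]] pure_tensor_eq[OF upd[OF b]] pure_tensor_eq[OF upd[OF ab]]
        by (rule add) (intro tensor_gen_closed v upd a b ab)+
    next
      fix c a assume c: "c \<in> carrier K" and a: "a \<in> carrier A"
      have ca: "c \<odot>\<^bsub>A\<^esub> a \<in> carrier A" using c a by simp
      have "free_gen K (v, as[j := c \<odot>\<^bsub>A\<^esub> a]) \<ominus>\<^bsub>?F\<^esub> c \<odot>\<^bsub>?F\<^esub> free_gen K (v, as[j := a])
          \<in> tensor_relations K V A n"
        using as v j a c unfolding tensor_relations_def Let_def by blast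
      then show "pure_tensor K A V v (as[j := c \<odot>\<^bsub>A\<^esub> a])
          = c \<odot>\<^bsub>?C\<^esub> pure_tensor K A V v (as[j := a])"
        unfolding pure_tensor_eq[OF upd[OF a]] pure_tensor_eq[OF upd[OF ca]]
        by (rule smult) (intro tensor_gen_closed v upd a ca c)+
    qed (rule pure_tensor_closed[OF v upd])
  qed
qed

text \<open>Existence half of the universal property: extend \<phi> linearly to the free module,
  check that the extension kills the relations, and descend to the quotient.\<close>

lemma tensor_lift:
  assumes P: "module K P" and \<phi>: "\<phi> \<in> multilinear_maps K A V n P"
  obtains f where "f \<in> linear_maps K (C_Hom K A V n) P"
    and "\<And>v as. \<lbrakk>v \<in> carrier V; as \<in> tuples A n\<rbrakk> \<Longrightarrow> f (pure_tensor K A V v as) = \<phi> v as"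
proof -
  interpret P: module K P by fact
  let ?F = "tensor_free K V A n" and ?N = "tensor_null K V A n"
  define \<psi> where "\<psi> = (\<lambda>(v, as). \<phi> v as)"
  define \<Phi> where "\<Phi> = free_lift K P \<psi>"
  interpret F: module K ?F by (rule module_tensor_free)
  note first = linear_mapsD[OF multilinear_maps_first[OF \<phi>]]
  note update = linear_mapsD[OF multilinear_maps_update[OF \<phi>]]
  have \<psi>: "\<psi> \<in> carrier V \<times> tuples A n \<rightarrow> carrier P"
    using first(1) by (auto simp: \<psi>_def)
  have \<Phi>: "\<Phi> \<in> linear_maps K ?F P"
    unfolding \<Phi>_def tensor_free_def by (rule P.free_lift_linear[OF \<psi>])
  have gen: "\<Phi> (free_gen K (v, as)) = \<phi> v as" if "v \<in> carrier V" "as \<in> tuples A n" for v as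
    unfolding \<Phi>_def using that by (simp add: P.free_lift_gen[OF \<psi>]) (simp add: \<psi>_def)
  have zero: "(\<lambda>x. \<zero>\<^bsub>P\<^esub>) \<in> linear_maps K ?F P"
    by (rule linear_mapsI) simp_all
  \<comment> \<open>Every relation has the form x - y, so killing it amounts to \<Phi> x = \<Phi> y,
    which is an instance of the multilinearity of \<phi>.\<close>
  have diff: "\<Phi> (x \<ominus>\<^bsub>?F\<^esub> y) = \<zero>\<^bsub>P\<^esub>"
    if "\<Phi> x = \<Phi> y" "x \<in> carrier ?F" "y \<in> carrier ?F" for x y
    using linear_maps_minus[OF F.module_axioms P \<Phi> that(2,3)] linear_maps_closed[OF \<Phi> that(3)] that(1)
    by (simp add: P.M.minus_eq P.M.r_neg)
  have "\<Phi> r = \<zero>\<^bsub>P\<^esub>" if "r \<in> tensor_relations K V A n" for r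
    using that
    by (cases rule: tensor_relationsE)
      (auto intro!: diff simp: linear_mapsD[OF \<Phi>] gen tensor_gen_closed tuples_update first update)
  \<comment> \<open>The kernel of \<Phi>, as the equalizer with the zero map, is a submodule
    containing the relations, hence it contains their hull.\<close>
  then have "?N \<subseteq> {x \<in> carrier ?F. \<Phi> x = \<zero>\<^bsub>P\<^esub>}"
    unfolding tensor_null_def using tensor_relations_closed
    by (intro hull_minimal linear_maps_equalizer[OF F.module_axioms P \<Phi> zero]) auto
  then have null: "\<Phi> x = \<zero>\<^bsub>P\<^esub>" if "x \<in> ?N" for x using that by auto
  show thesis
  proof
    show "quotient_lift \<Phi> \<in> linear_maps K (C_Hom K A V n) P"
      unfolding C_Hom_def by (rule F.quotient_lift_linear[OF submodule_tensor_null P \<Phi> null])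
    show "quotient_lift \<Phi> (pure_tensor K A V v as) = \<phi> v as"
      if "v \<in> carrier V" "as \<in> tuples A n" for v as
      using that
      by (simp add: pure_tensor_eq F.quotient_lift[OF submodule_tensor_null P \<Phi> null] tensor_gen_closed gen)
  qed
qed

text \<open>Uniqueness half of the universal property. Both maps are pulled back to the free module,
  where their equalizer is a submodule containing all generators.\<close>

lemma tensor_eqI:
  assumes P: "module K P"
    and f: "f \<in> linear_maps K (C_Hom K A V n) P" and g: "g \<in> linear_maps K (C_Hom K A V n) P"
    and eq: "\<And>v as. \<lbrakk>v \<in> carrier V; as \<in> tuples A n\<rbrakk> \<Longrightarrow>
      f (pure_tensor K A V v as) = g (pure_tensor K A V v as)"
    and x: "x \<in> carrier (C_Hom K A V n)"
  shows "f x = g x"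
proof -
  let ?F = "tensor_free K V A n"
  let ?c = "\<lambda>x. tensor_null K V A n +>\<^bsub>?F\<^esub> x"
  interpret F: module K ?F by (rule module_tensor_free)
  obtain y where y: "y \<in> carrier ?F" "x = ?c y"
    using x unfolding C_Hom_def by (rule F.quotient_carrierE)
  have c: "?c \<in> linear_maps K ?F (C_Hom K A V n)"
    unfolding C_Hom_def by (rule F.coset_linear[OF submodule_tensor_null])
  define H where "H = {x \<in> carrier ?F. f (?c x) = g (?c x)}"
  have H: "submodule H K ?F"
    unfolding H_def
    by (rule linear_maps_equalizer[OF F.module_axioms P linear_maps_compose[OF c f] linear_maps_compose[OF c g]])
  have "y \<in> H"
  proof (rule A.free_module_generated[OF H[unfolded tensor_free_def]])
    fix s assume "s \<in> carrier V \<times> tuples A n"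
    then obtain v as where s: "s = (v, as)" "v \<in> carrier V" "as \<in> tuples A n" by blast
    then show "free_gen K s \<in> H"
      using eq[OF s(2,3)] by (simp add: H_def tensor_gen_closed pure_tensor_eq[OF s(3)])
  qed (use y in \<open>simp add: tensor_free_def\<close>)
  then have "f (?c y) = g (?c y)" by (simp add: H_def)
  with y(2) show ?thesis by simp
qed

end


section \<open>The Hom face maps\<close>

context hom_bimodule
begin

sublocale two_modules K A V
  by (intro two_modules.intro module_axioms V.module_axioms)

section \<open>Multilinearity of the face formulas and existence of the face maps\<close>

lemma mu_closed: "\<lbrakk>a \<in> carrier A; b \<in> carrier A\<rbrakk> \<Longrightarrow> mu a b \<in> carrier A"
  and alpha_closed: "a \<in> carrier A \<Longrightarrow> \<alpha> a \<in> carrier A"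
  and lact_closed: "\<lbrakk>a \<in> carrier A; v \<in> carrier V\<rbrakk> \<Longrightarrow> lact a v \<in> carrier V"
  and ract_closed: "\<lbrakk>a \<in> carrier A; v \<in> carrier V\<rbrakk> \<Longrightarrow> ract v a \<in> carrier V"
  and beta_closed: "v \<in> carrier V \<Longrightarrow> \<beta> v \<in> carrier V"
  using mu_bilinear alpha_linear lact_bilinear ract_bilinear beta_linear
  by (auto simp: bilinear_maps_def dest: linear_maps_closed)

lemmas act_closed = mu_closed alpha_closed lact_closed ract_closed beta_closed

lemma map_alpha_closed: "as \<in> tuples A n \<Longrightarrow> map \<alpha> as \<in> tuples A n"
  by (auto simp: tuples_def alpha_closed)

text \<open>The face formulas as functions of the whole tuple, the shape that
  \<open>tensor_lift\<close> needs. They are meant for n \<ge> 1, where \<open>hd\<close> and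
  \<open>last\<close> see a nonempty list and the tests \<open>i = 0\<close> and
  \<open>i = n\<close> exclude each other.\<close>

definition face_tensor :: "nat \<Rightarrow> nat \<Rightarrow> 'v \<Rightarrow> 'a list \<Rightarrow> ('v \<times> 'a list \<Rightarrow> 'k) set"
  where "face_tensor n i v as =
    (if i = 0 then pure_tensor K A V (ract v (hd as)) (map \<alpha> (tl as))
     else if i = n then pure_tensor K A V (lact (last as) v) (map \<alpha> (butlast as))
     else pure_tensor K A V (\<beta> v)
       (map \<alpha> (take (i - 1) as) @ mu (as ! (i - 1)) (as ! i) # map \<alpha> (drop (i + 1) as)))"

lemma face_tensor_first:
  "face_tensor n 0 v (a # as) = pure_tensor K A V (ract v a) (map \<alpha> as)"
  by (simp add: face_tensor_def)

lemma face_tensor_last: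
  "n \<noteq> 0 \<Longrightarrow> face_tensor n n v (as @ [a]) = pure_tensor K A V (lact a v) (map \<alpha> as)"
  by (simp add: face_tensor_def)

lemma face_tensor_inner:
  "\<lbrakk>i = Suc (length as); i < n\<rbrakk> \<Longrightarrow> face_tensor n i v (as @ a # b # bs)
    = pure_tensor K A V (\<beta> v) (map \<alpha> as @ mu a b # map \<alpha> bs)"
  by (simp add: face_tensor_def nth_append)

text \<open>Changing one input slot changes exactly one factor of the output, and does so through a
  linear map: \<alpha>, \<beta>, or one of the products with its other argument fixed. Composing
  this map with the multilinear \<open>pure_tensor\<close> gives linearity.\<close>

lemma face_tensor_multilinear:
  assumes n: "1 \<le> n" and i: "i \<le> n"
  shows "face_tensor n i \<in> multilinear_maps K A V n (C_Hom K A V (n - 1))"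
  unfolding multilinear_maps_def
proof (intro CollectI conjI ballI allI impI)
  let ?t = "pure_tensor K A V" and ?C = "C_Hom K A V (n - 1)"
  \<comment> \<open>\<open>M\<close> is kept general because the factor in \<open>V\<close> can vary
    with \<open>v\<close> itself (\<open>M\<close> is \<open>V\<close>) or with the algebra element
    acting on it (\<open>M\<close> is \<open>A\<close>).\<close>
  have first: "(\<lambda>v. ?t (h v) as) \<in> linear_maps K M ?C"
    if "as \<in> tuples A (n - 1)" "h \<in> linear_maps K M V"
    for h as and M :: "('k, 'x, 'y) module_scheme"
    using that by (rule linear_maps_compose[OF _ multilinear_maps_first[OF pure_tensor_multilinear], rotated])
  have update: "(\<lambda>a. ?t v (as[j := h a])) \<in> linear_maps K A ?C"
    if "as \<in> tuples A (n - 1)" "v \<in> carrier V" "j < n - 1" "h \<in> linear_maps K A A" for h as v j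
    by (rule linear_maps_compose[OF that(4) multilinear_maps_update[OF pure_tensor_multilinear that(1-3)]])
  have lact: "a \<in> carrier A \<Longrightarrow> lact a \<in> linear_maps K V V"
      "v \<in> carrier V \<Longrightarrow> (\<lambda>a. lact a v) \<in> linear_maps K A V"
    and ract: "a \<in> carrier A \<Longrightarrow> (\<lambda>v. ract v a) \<in> linear_maps K V V"
      "v \<in> carrier V \<Longrightarrow> ract v \<in> linear_maps K A V"
    and mu: "a \<in> carrier A \<Longrightarrow> mu a \<in> linear_maps K A A"
      "a \<in> carrier A \<Longrightarrow> (\<lambda>b. mu b a) \<in> linear_maps K A A" for a v
    using lact_bilinear ract_bilinear mu_bilinear by (auto simp: bilinear_maps_def)
  fix as assume as: "as \<in> tuples A n"
  consider "i = 0" | "i = n" | "1 \<le> i" "i < n" using i by linarith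
  then show "(\<lambda>v. face_tensor n i v as) \<in> linear_maps K V ?C"
  proof cases
    case 1
    obtain a bs where "as = a # bs" "a \<in> carrier A" "bs \<in> tuples A (n - 1)"
      by (rule tuples_cases_first[OF as n])
    then show ?thesis
      using 1 first[OF map_alpha_closed ract(1)] by (simp add: face_tensor_first)
  next
    case 2
    obtain bs a where "as = bs @ [a]" "a \<in> carrier A" "bs \<in> tuples A (n - 1)"
      by (rule tuples_cases_last[OF as n])
    then show ?thesis
      using 2 n first[OF map_alpha_closed lact(1)] by (simp add: face_tensor_last)
  next
    case 3
    obtain xs a b ys where "as = xs @ a # b # ys" "xs \<in> tuples A (i - 1)"
        "a \<in> carrier A" "b \<in> carrier A" "ys \<in> tuples A (n - 1 - i)"
      by (rule tuples_cases_inner[OF as 3])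
    moreover from this have "map \<alpha> xs @ mu a b # map \<alpha> ys \<in> tuples A (n - 1)"
      using 3 by (auto simp: tuples_def alpha_closed mu_closed)
    ultimately show ?thesis
      using 3 first[OF _ beta_linear] by (simp add: face_tensor_inner tuples_def)
  qed
  fix v j assume v: "v \<in> carrier V" and j: "j < n"
  consider "i = 0" | "i = n" | "1 \<le> i" "i < n" using i by linarith
  then show "(\<lambda>x. face_tensor n i v (as[j := x])) \<in> linear_maps K A ?C"
  proof cases
    case 1
    obtain a bs where a: "as = a # bs" "a \<in> carrier A" and bs: "bs \<in> tuples A (n - 1)"
      by (rule tuples_cases_first[OF as n])
    show ?thesis
    proof (cases j)
      case 0
      then show ?thesis
        using 1 a first[OF map_alpha_closed[OF bs] ract(2)[OF v]] by (simp add: face_tensor_first)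
    next
      case (Suc k)
      then have "k < n - 1" using j by simp
      from update[OF map_alpha_closed[OF bs] ract_closed[OF a(2) v] this alpha_linear]
      show ?thesis using 1 a Suc by (simp add: face_tensor_first map_update)
    qed
  next
    case 2
    obtain bs a where a: "as = bs @ [a]" "a \<in> carrier A" and bs: "bs \<in> tuples A (n - 1)"
      by (rule tuples_cases_last[OF as n])
    have len: "length bs = n - 1" using bs by (simp add: tuples_def)
    show ?thesis
    proof (cases "j = n - 1")
      case True
      have "(\<lambda>x. face_tensor n i v (as[j := x])) = (\<lambda>x. ?t (lact x v) (map \<alpha> bs))"
        using 2 a n True len by (simp add: face_tensor_last list_update_append)
      then show ?thesis using first[OF map_alpha_closed[OF bs] lact(2)[OF v]] by simp
    next
      case False
      then have jn: "j < n - 1" using j by simp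
      have "(\<lambda>x. face_tensor n i v (as[j := x])) = (\<lambda>x. ?t (lact a v) ((map \<alpha> bs)[j := \<alpha> x]))"
        using 2 a n jn len by (simp add: face_tensor_last list_update_append map_update)
      then show ?thesis
        using update[OF map_alpha_closed[OF bs] lact_closed[OF a(2) v] jn alpha_linear] by simp
    qed
  next
    case 3
    obtain xs a b ys where dec: "as = xs @ a # b # ys" "xs \<in> tuples A (i - 1)"
        "a \<in> carrier A" "b \<in> carrier A" "ys \<in> tuples A (n - 1 - i)"
      by (rule tuples_cases_inner[OF as 3])
    have len: "i = Suc (length xs)" "length ys = n - 1 - i"
      using dec 3 by (simp_all add: tuples_def)
    let ?bs = "map \<alpha> xs @ mu a b # map \<alpha> ys"
    have bs: "?bs \<in> tuples A (n - 1)"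
      using dec 3 by (auto simp: tuples_def alpha_closed mu_closed)
    note less = 3(2)
    note upd = update[OF bs beta_closed[OF v]]
    \<comment> \<open>Slots before the product keep their position; the two multiplied slots both
      feed output slot \<open>length xs\<close>; every later slot moves one place to the
      left.\<close>
    consider "j < length xs" | "j = length xs" | "j = Suc (length xs)"
      | k where "j = length xs + 2 + k"
      by (metis add_2_eq_Suc' less_iff_Suc_add linorder_neqE_nat not_less_eq add_Suc_right add_Suc)
    then show ?thesis
    proof cases
      case 1
      then have "(\<lambda>x. face_tensor n i v (as[j := x])) = (\<lambda>x. ?t (\<beta> v) (?bs[j := \<alpha> x]))"
        using dec(1) len less by (simp add: list_update_append map_update face_tensor_inner)
      then show ?thesis using upd[of j, OF _ alpha_linear] 1 len 3 by simp
    next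
      case 2
      then have "(\<lambda>x. face_tensor n i v (as[j := x])) = (\<lambda>x. ?t (\<beta> v) (?bs[j := mu x b]))"
        using dec(1) len less by (simp add: list_update_append face_tensor_inner)
      then show ?thesis using upd[of j, OF _ mu(2)[OF dec(4)]] 2 len 3 by simp
    next
      case 3
      then have "(\<lambda>x. face_tensor n i v (as[j := x])) = (\<lambda>x. ?t (\<beta> v) (?bs[length xs := mu a x]))"
        using dec(1) len less by (simp add: list_update_append face_tensor_inner)
      then show ?thesis using upd[of "length xs", OF _ mu(1)[OF dec(3)]] len less by simp
    next
      case (4 k)
      then have "(\<lambda>x. face_tensor n i v (as[j := x])) = (\<lambda>x. ?t (\<beta> v) (?bs[length xs + 1 + k := \<alpha> x]))"
        using dec(1) len less by (simp add: list_update_append map_update face_tensor_inner)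
      moreover have "length xs + 1 + k < n - 1" using 4 j by simp
      ultimately show ?thesis using upd[of "length xs + 1 + k", OF _ alpha_linear] by simp
    qed
  qed
qed

lemma hom_face_maps_exist: "\<exists>\<delta>. hom_face_maps K A mu \<alpha> V lact ract \<beta> \<delta>"
proof -
  let ?face = "\<lambda>n i f. f \<in> linear_maps K (C_Hom K A V n) (C_Hom K A V (n - 1)) \<and>
    (\<forall>v\<in>carrier V. \<forall>as\<in>tuples A n. f (pure_tensor K A V v as) = face_tensor n i v as)"
  have "\<exists>f. ?face n i f" if "1 \<le> n" "i \<le> n" for n i
    by (rule tensor_lift[OF module_C_Hom face_tensor_multilinear[OF that]]) blast
  \<comment> \<open>The universal property yields one map for each pair of indices; they are chosen
    simultaneously to form \<delta>.\<close>
  then obtain \<delta> where \<delta>: "\<And>n i. \<lbrakk>1 \<le> n; i \<le> n\<rbrakk> \<Longrightarrow> ?face n i (\<delta> n i)" by metis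
  have lin: "\<delta> n i \<in> linear_maps K (C_Hom K A V n) (C_Hom K A V (n - 1))"
    if "1 \<le> n" "i \<le> n" for n i using \<delta>[OF that] by blast
  have eq: "\<delta> n i (pure_tensor K A V v as) = face_tensor n i v as"
    if "1 \<le> n" "i \<le> n" "v \<in> carrier V" "set as \<subseteq> carrier A" "length as = n" for n i v as
    using \<delta>[OF that(1,2)] that(3-5) by (simp add: tuples_def)
  have "hom_face_maps K A mu \<alpha> V lact ract \<beta> \<delta>"
    unfolding hom_face_maps_def Let_def
  proof (intro allI impI conjI ballI)
    fix n :: nat assume n: "1 \<le> n"
    show "\<delta> n i \<in> linear_maps K (C_Hom K A V n) (C_Hom K A V (n - 1))" if "i \<le> n" for i
      by (rule lin[OF n that])
    fix v assume v: "v \<in> carrier V"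
    show "\<delta> n 0 (pure_tensor K A V v (a # as)) = pure_tensor K A V (ract v a) (map \<alpha> as)"
      if "a \<in> carrier A" "as \<in> tuples A (n - 1)" for a as
      using n v that by (subst eq) (auto simp: tuples_def face_tensor_first)
    show "\<delta> n n (pure_tensor K A V v (as @ [a])) = pure_tensor K A V (lact a v) (map \<alpha> as)"
      if "as \<in> tuples A (n - 1)" "a \<in> carrier A" for a as
      using n v that by (subst eq) (auto simp: tuples_def face_tensor_last)
    show "\<delta> n i (pure_tensor K A V v (as @ [a, b] @ bs))
        = pure_tensor K A V (\<beta> v) (map \<alpha> as @ [mu a b] @ map \<alpha> bs)"
      if "1 \<le> i \<and> i \<le> n - 1" "as \<in> tuples A (i - 1)" "a \<in> carrier A" "b \<in> carrier A"
        "bs \<in> tuples A (n - 1 - i)" for i as a b bs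
      using n v that by (subst eq) (auto simp: tuples_def face_tensor_inner)
  qed
  then show ?thesis by blast
qed

end

section \<open>The presimplicial identities\<close>

locale multiplicative_hom_bimodule =
  multiplicative_hom_associative_algebra K A mu \<alpha> + hom_bimodule K A mu \<alpha> V lact ract \<beta>
  for K :: "('k, 'r) ring_scheme" and A :: "('k, 'a, 'm) module_scheme"
    and mu :: "'a \<Rightarrow> 'a \<Rightarrow> 'a" and \<alpha> :: "'a \<Rightarrow> 'a"
    and V :: "('k, 'v, 'n) module_scheme"
    and lact :: "'a \<Rightarrow> 'v \<Rightarrow> 'v" and ract :: "'v \<Rightarrow> 'a \<Rightarrow> 'v" and \<beta> :: "'v \<Rightarrow> 'v" +
  assumes beta_ract: "\<lbrakk>a \<in> carrier A; v \<in> carrier V\<rbrakk> \<Longrightarrow> \<beta> (ract v a) = ract (\<beta> v) (\<alpha> a)"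
    and beta_lact: "\<lbrakk>a \<in> carrier A; v \<in> carrier V\<rbrakk> \<Longrightarrow> \<beta> (lact a v) = lact (\<alpha> a) (\<beta> v)"
begin

lemma hom_face_maps_presimplicial:
  assumes \<delta>: "hom_face_maps K A mu \<alpha> V lact ract \<beta> \<delta>"
  shows "presimplicial_module K (C_Hom K A V) \<delta>"
proof -
  let ?t = "pure_tensor K A V"
  have lin: "\<delta> n i \<in> linear_maps K (C_Hom K A V n) (C_Hom K A V (n - 1))"
    if "1 \<le> n" "i \<le> n" for n i
    using \<delta> that unfolding hom_face_maps_def Let_def by blast
  have first: "\<delta> n 0 (?t v (a # as)) = ?t (ract v a) (map \<alpha> as)"
    if "v \<in> carrier V" "a \<in> carrier A" "set as \<subseteq> carrier A" "n = Suc (length as)" for n v a as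
    using \<delta> that unfolding hom_face_maps_def Let_def by (auto simp: tuples_def)
  \<comment> \<open>A separate \<open>n'\<close> lets the rule apply when degree and face index are
    written differently, such as \<open>n - 1\<close> and \<open>j - 1\<close>.\<close>
  have last: "\<delta> n n' (?t v (as @ [a])) = ?t (lact a v) (map \<alpha> as)"
    if "v \<in> carrier V" "a \<in> carrier A" "set as \<subseteq> carrier A" "n = Suc (length as)" "n' = n"
    for n n' v a as
    using \<delta> that unfolding hom_face_maps_def Let_def by (auto simp: tuples_def)
  have inner: "\<delta> n i (?t v (as @ a # b # bs)) = ?t (\<beta> v) (map \<alpha> as @ mu a b # map \<alpha> bs)"
    if "v \<in> carrier V" "a \<in> carrier A" "b \<in> carrier A" "set as \<subseteq> carrier A" "set bs \<subseteq> carrier A"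
      "n = Suc (Suc (length as + length bs))" "i = Suc (length as)" for n i v a b as bs
  proof -
    have "1 \<le> n" "1 \<le> i \<and> i \<le> n - 1" "as \<in> tuples A (i - 1)" "bs \<in> tuples A (n - 1 - i)"
      using that by (auto simp: tuples_def)
    then have "\<delta> n i (?t v (as @ [a, b] @ bs)) = ?t (\<beta> v) (map \<alpha> as @ [mu a b] @ map \<alpha> bs)"
      using \<delta> that(1-3) unfolding hom_face_maps_def Let_def by blast
    then show ?thesis by simp
  qed
  have ident: "\<delta> (n - 1) i (\<delta> n j (?t v as)) = \<delta> (n - 1) (j - 1) (\<delta> n i (?t v as))"
    if n: "2 \<le> n" and ij: "i < j" and jn: "j \<le> n" and v: "v \<in> carrier V" and as: "as \<in> tuples A n"
    for n i j v as
  proof -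
    note cl = act_closed v
    have map_cl: "\<alpha> ` X \<subseteq> carrier A" if "X \<subseteq> carrier A" for X
      using that alpha_closed by auto
    have n1: "1 \<le> n" "1 \<le> n - 1" using n by simp_all
    \<comment> \<open>The overlapping pairs are \<open>A_first\<close>, \<open>A_last\<close>,
      \<open>last_two\<close> and \<open>overlap\<close>; the other three have no common factor.
      Since n \<ge> 2, the face with j = 1 is always an inner one in degree
      \<open>n\<close>.\<close>
    consider (A_first) "i = 0" "j = 1" | (A_inner) "i = 0" "1 < j" "j < n" | (A_last) "i = 0" "j = n"
      | (last_two) "1 \<le> i" "i = n - 1" "j = n" | (inner_last) "1 \<le> i" "i < n - 1" "j = n"
      | (overlap) "1 \<le> i" "j = i + 1" "j < n" | (disjoint) "1 \<le> i" "i + 1 < j" "j < n"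
    proof (cases "i = 0")
      case True
      then have "j = 1 \<or> 1 < j \<and> j < n \<or> j = n" using ij jn by linarith
      with True show ?thesis using A_first A_inner A_last by blast
    next
      case False
      then have "i = n - 1 \<and> j = n \<or> i < n - 1 \<and> j = n \<or> j = i + 1 \<and> j < n \<or> i + 1 < j \<and> j < n"
        and "1 \<le> i"
        using ij jn by linarith+
      then show ?thesis using last_two inner_last overlap disjoint by blast
    qed
    then show ?thesis
    proof cases
      \<comment> \<open>The factor in \<open>V\<close> is \<beta>(v) acted on by ab on one side, and
        v acted on by a and then by \<alpha>(b) on the other.\<close>
      case A_first
      obtain a cs where a: "as = a # cs" "a \<in> carrier A" and cs: "cs \<in> tuples A (n - 1)"
        by (rule tuples_cases_first[OF as n1(1)])
      obtain b bs where b: "cs = b # bs" "b \<in> carrier A" "bs \<in> tuples A (n - 1 - 1)"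
        by (rule tuples_cases_first[OF cs n1(2)])
      have bs: "set bs \<subseteq> carrier A" "n = Suc (Suc (length bs))" using b n by (auto simp: tuples_def)
      show ?thesis
        using inner[of v a b "[]" bs n j] first[of v a "b # bs" n] a b bs A_first
        by (simp add: first cl map_cl right_module)
    next
      \<comment> \<open>The factor in \<open>V\<close> needs \<open>beta_ract\<close>, the product
        of b and c needs \<open>alpha_mult\<close>.\<close>
      case A_inner
      obtain a cs where a: "as = a # cs" "a \<in> carrier A" and cs: "cs \<in> tuples A (n - 1)"
        by (rule tuples_cases_first[OF as n1(1)])
      have "1 \<le> j - 1" "j - 1 < n - 1" using A_inner by simp_all
      from cs this obtain xs b c ys where d: "cs = xs @ b # c # ys" "xs \<in> tuples A (j - 1 - 1)"
          "b \<in> carrier A" "c \<in> carrier A" "ys \<in> tuples A (n - 1 - 1 - (j - 1))"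
        by (rule tuples_cases_inner)
      have s: "set xs \<subseteq> carrier A" "set ys \<subseteq> carrier A" "j = Suc (Suc (length xs))"
          "n = Suc (Suc (Suc (length xs + length ys)))"
        using d A_inner by (auto simp: tuples_def)
      have "\<delta> (n - 1) i (\<delta> n j (?t v as))
          = ?t (ract (\<beta> v) (\<alpha> a)) (map \<alpha> (map \<alpha> xs @ mu b c # map \<alpha> ys))"
        using inner[of v b c "a # xs" ys n j] a d s A_inner by (simp add: first cl map_cl)
      also have "\<dots> = \<delta> (n - 1) (j - 1) (\<delta> n i (?t v as))"
        using first[of v a "xs @ b # c # ys" n] a d s A_inner
          inner[of "ract v a" "\<alpha> b" "\<alpha> c" "map \<alpha> xs" "map \<alpha> ys" "n - 1" "j - 1"]
        by (simp add: cl map_cl beta_ract alpha_mult)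
      finally show ?thesis .
    next
      \<comment> \<open>The two outer faces act on v from opposite sides, so exchanging them is the
        bimodule compatibility.\<close>
      case A_last
      obtain a cs where a: "as = a # cs" "a \<in> carrier A" and cs: "cs \<in> tuples A (n - 1)"
        by (rule tuples_cases_first[OF as n1(1)])
      obtain bs b where b: "cs = bs @ [b]" "bs \<in> tuples A (n - 1 - 1)" "b \<in> carrier A"
        by (rule tuples_cases_last[OF cs n1(2)])
      have bs: "set bs \<subseteq> carrier A" "n = Suc (Suc (length bs))" using b n by (auto simp: tuples_def)
      show ?thesis
        using last[of v b "a # bs" n n] first[of v a "bs @ [b]" n] a b bs A_last
        by (simp add: first last cl map_cl bimodule)
    next
      \<comment> \<open>The index n - 1 denotes an inner face in degree \<open>n\<close> but the
        last face in degree \<open>n - 1\<close>. Both sides thus let a and b act on v from the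
        left.\<close>
      case last_two
      obtain cs b where b: "as = cs @ [b]" "b \<in> carrier A" and cs: "cs \<in> tuples A (n - 1)"
        by (rule tuples_cases_last[OF as n1(1)])
      obtain bs a where a: "cs = bs @ [a]" "bs \<in> tuples A (n - 1 - 1)" "a \<in> carrier A"
        by (rule tuples_cases_last[OF cs n1(2)])
      have bs: "set bs \<subseteq> carrier A" "n = Suc (Suc (length bs))" using a n by (auto simp: tuples_def)
      show ?thesis
        using last[of v b "bs @ [a]" n n] inner[of v a b bs "[]" n i] a b bs last_two
        by (simp add: last cl map_cl left_module)
    next
      \<comment> \<open>Mirror image of \<open>A_inner\<close>, with \<open>beta_lact\<close> for
        the factor in \<open>V\<close>.\<close>
      case inner_last
      obtain cs c where c: "as = cs @ [c]" "c \<in> carrier A" and cs: "cs \<in> tuples A (n - 1)"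
        by (rule tuples_cases_last[OF as n1(1)])
      obtain xs a b ys where d: "cs = xs @ a # b # ys" "xs \<in> tuples A (i - 1)"
          "a \<in> carrier A" "b \<in> carrier A" "ys \<in> tuples A (n - 1 - 1 - i)"
        by (rule tuples_cases_inner[OF cs inner_last(1,2)])
      have s: "set xs \<subseteq> carrier A" "set ys \<subseteq> carrier A" "i = Suc (length xs)"
          "n = Suc (Suc (Suc (length xs + length ys)))"
        using d inner_last by (auto simp: tuples_def)
      have "\<delta> (n - 1) i (\<delta> n j (?t v as))
          = ?t (\<beta> (lact c v)) (map \<alpha> (map \<alpha> xs) @ mu (\<alpha> a) (\<alpha> b) # map \<alpha> (map \<alpha> ys))"
        using last[of v c "xs @ a # b # ys" n n] c d s inner_last
          inner[of "lact c v" "\<alpha> a" "\<alpha> b" "map \<alpha> xs" "map \<alpha> ys" "n - 1" i]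
        by (simp add: cl map_cl)
      also have "\<dots> = \<delta> (n - 1) (j - 1) (\<delta> n i (?t v as))"
        using inner[of v a b xs "ys @ [c]" n i] c d s inner_last
          last[of "\<beta> v" "\<alpha> c" "map \<alpha> xs @ mu a b # map \<alpha> ys" "n - 1" "j - 1"]
        by (simp add: cl map_cl beta_lact alpha_mult)
      finally show ?thesis .
    next
      \<comment> \<open>Here j - 1 = i: after either first face the second one multiplies at the
        same position, giving \<alpha>(a)(bc) and (ab)\<alpha>(c).\<close>
      case overlap
      then have "i < n" by simp
      from as overlap(1) this obtain xs a b cs where d: "as = xs @ a # b # cs"
          "xs \<in> tuples A (i - 1)" "a \<in> carrier A" "b \<in> carrier A"
        and cs: "cs \<in> tuples A (n - 1 - i)"
        by (rule tuples_cases_inner)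
      have "1 \<le> n - 1 - i" using overlap by simp
      with cs obtain c ys where e: "cs = c # ys" "c \<in> carrier A" "ys \<in> tuples A (n - 1 - i - 1)"
        by (rule tuples_cases_first)
      have s: "set xs \<subseteq> carrier A" "set ys \<subseteq> carrier A" "i = Suc (length xs)"
          "n = Suc (Suc (Suc (length xs + length ys)))"
        using d e overlap by (auto simp: tuples_def)
      have "\<delta> (n - 1) i (\<delta> n j (?t v as))
          = ?t (\<beta> (\<beta> v)) (map \<alpha> (map \<alpha> xs) @ mu (\<alpha> a) (mu b c) # map \<alpha> (map \<alpha> ys))"
        using inner[of v b c "xs @ [a]" ys n j] d e s overlap
          inner[of "\<beta> v" "\<alpha> a" "mu b c" "map \<alpha> xs" "map \<alpha> ys" "n - 1" i]
        by (simp add: cl map_cl)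
      also have "\<dots> = \<delta> (n - 1) (j - 1) (\<delta> n i (?t v as))"
        using inner[of v a b xs "c # ys" n i] d e s overlap
          inner[of "\<beta> v" "mu a b" "\<alpha> c" "map \<alpha> xs" "map \<alpha> ys" "n - 1" "j - 1"]
        by (simp add: cl map_cl hom_assoc)
      finally show ?thesis .
    next
      \<comment> \<open>Merging a and b first moves the pair c, d one place to the left, which
        accounts for the index j - 1. Each product is twisted on one side and built from twisted
        factors on the other.\<close>
      case disjoint
      then have "1 \<le> j" by simp
      from as this disjoint(3) obtain ws c d zs where d: "as = ws @ c # d # zs"
          "c \<in> carrier A" "d \<in> carrier A" "zs \<in> tuples A (n - 1 - j)"
        and ws: "ws \<in> tuples A (j - 1)"
        by (rule tuples_cases_inner)
      have "i < j - 1" using disjoint by simp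
      with ws disjoint(1) obtain xs a b ys where e: "ws = xs @ a # b # ys" "xs \<in> tuples A (i - 1)"
          "a \<in> carrier A" "b \<in> carrier A" "ys \<in> tuples A (j - 1 - 1 - i)"
        by (rule tuples_cases_inner)
      have s: "set xs \<subseteq> carrier A" "set ys \<subseteq> carrier A" "set zs \<subseteq> carrier A"
          "i = Suc (length xs)" "j = Suc (Suc (Suc (length xs + length ys)))"
          "n = Suc (Suc (Suc (Suc (length xs + length ys + length zs))))"
        using d e disjoint by (auto simp: tuples_def)
      have "\<delta> (n - 1) i (\<delta> n j (?t v as)) = ?t (\<beta> (\<beta> v))
          (map \<alpha> (map \<alpha> xs) @ mu (\<alpha> a) (\<alpha> b) # map \<alpha> (map \<alpha> ys @ mu c d # map \<alpha> zs))"
        using inner[of v c d "xs @ a # b # ys" zs n j] d e s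
          inner[of "\<beta> v" "\<alpha> a" "\<alpha> b" "map \<alpha> xs" "map \<alpha> ys @ mu c d # map \<alpha> zs" "n - 1" i]
        by (simp add: cl map_cl)
      also have "\<dots> = \<delta> (n - 1) (j - 1) (\<delta> n i (?t v as))"
        using inner[of v a b xs "ys @ c # d # zs" n i] d e s
          inner[of "\<beta> v" "\<alpha> c" "\<alpha> d" "map \<alpha> xs @ mu a b # map \<alpha> ys" "map \<alpha> zs" "n - 1" "j - 1"]
        by (simp add: cl map_cl alpha_mult)
      finally show ?thesis .
    qed
  qed
  show ?thesis
    unfolding presimplicial_module_def
  proof (intro conjI allI impI ballI)
    fix n i j x assume n: "2 \<le> n" and ij: "i < j \<and> j \<le> n" and x: "x \<in> carrier (C_Hom K A V n)"
    \<comment> \<open>Both sides of the identity are linear in \<open>x\<close>, so agreement on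
      pure tensors is enough.\<close>
    have comp: "(\<lambda>x. \<delta> (n - 1) k (\<delta> n l x)) \<in> linear_maps K (C_Hom K A V n) (C_Hom K A V (n - 1 - 1))"
      if "k \<le> n - 1" "l \<le> n" for k l
      using that n by (intro linear_maps_compose[OF lin lin]) simp_all
    have "i \<le> n" "j \<le> n" "i < j" "i \<le> n - 1" "j - 1 \<le> n - 1" using ij by linarith+
    then show "\<delta> (n - 1) i (\<delta> n j x) = \<delta> (n - 1) (j - 1) (\<delta> n i x)"
      by (intro tensor_eqI[OF module_C_Hom comp comp ident x] n)
  qed (simp_all only: module_C_Hom lin)
qed

end

theorem theorem3p1:
  fixes K :: "('k, 'r) ring_scheme"
    and A :: "('k, 'a, 'm) module_scheme"
    and mu :: "'a \<Rightarrow> 'a \<Rightarrow> 'a" and \<alpha> :: "'a \<Rightarrow> 'a"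
    and V :: "('k, 'v, 'n) module_scheme"
    and lact :: "'a \<Rightarrow> 'v \<Rightarrow> 'v" and ract :: "'v \<Rightarrow> 'a \<Rightarrow> 'v" and \<beta> :: "'v \<Rightarrow> 'v"
  assumes "multiplicative_hom_associative_algebra K A mu \<alpha>"
    and "hom_bimodule K A mu \<alpha> V lact ract \<beta>"
    and "\<And>a v. \<lbrakk>a \<in> carrier A; v \<in> carrier V\<rbrakk> \<Longrightarrow> \<beta> (ract v a) = ract (\<beta> v) (\<alpha> a)"
    and "\<And>a v. \<lbrakk>a \<in> carrier A; v \<in> carrier V\<rbrakk> \<Longrightarrow> \<beta> (lact a v) = lact (\<alpha> a) (\<beta> v)"
  shows "(\<exists>\<delta>. hom_face_maps K A mu \<alpha> V lact ract \<beta> \<delta>) \<and>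
    (\<forall>\<delta>. hom_face_maps K A mu \<alpha> V lact ract \<beta> \<delta> \<longrightarrow>
      presimplicial_module K (C_Hom K A V) \<delta>)"
proof -
  interpret multiplicative_hom_bimodule K A mu \<alpha> V lact ract \<beta>
    using assms
    by (intro multiplicative_hom_bimodule.intro multiplicative_hom_bimodule_axioms.intro)
  show ?thesis
    using hom_face_maps_exist hom_face_maps_presimplicial by blast
qed

end
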